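(* Let $\mathcal{A}$ be a multiplicative algebra. Then $\mathcal{A}$ admits a decomposition $\mathcal{A}\cong\mathcal{A}_1\times\mathcal{A}_2\times\cdots\times\mathcal{A}_k\times\mathbb{R}^n\times\mathbb{C}^m$ as a product of finitely many unital nil algebras $\mathcal{A}_1,\dots,\mathcal{A}_k$ and finitely many copies of $\mathbb{R}$ and $\mathbb{C}$ (with $k,n,m\ge 0$), and the following hold. (1) If $\mathcal{A}$ is a type-R algebra, then there exists a unique inverse function to $\exp$ on $\mathrm{Ld}(\mathcal{A})$, denoted $\mathrm{Log}_{\mathcal{A}}(z)$. (2) Otherwise, there exist infinitely many logarithms for $\mathcal{A}$, determined by the branches of the logarithms defined on the complex portion of the algebra.
   Context: An algebra is a finite-dimensional associative commutative unital algebra over $\mathbb{R}$, with product $\star$ and unit $1$. The exponential is $\exp(z)=e^z=\sum_{k\ge 0} z^k/k!$, which converges for all $z\in\mathcal{A}$, and $\mathrm{Ld}(\mathcal{A})=\exp(\mathcal{A})$ denotes its image. A logarithm (a branch of the logarithm) for $\mathcal{A}$ is given by a connected subset $B\subseteq\mathcal{A}$ such that $\exp|_B$ is injective and $\exp(B)=\mathrm{Ld}(\mathcal{A})$, together with a function $\log:\mathrm{Ld}(\mathcal{A})\to B$ satisfying $\log(e^z)=z$ for all $z\in B$ and $e^{\log(z)}=z$ for all $z\in\mathrm{Ld}(\mathcal{A})$. A basis $\{v_1,\dots,v_n\}$ of an algebra is multiplicative if for all $i,j$ there are $c\in\mathbb{R}$ and a basis element $v_k$ with $v_i\star v_j=c\,v_k$;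 an algebra is multiplicative if it admits a multiplicative basis. A unital nil algebra is an algebra having a basis $\{1,\epsilon_1,\dots,\epsilon_r\}$ ($r\ge 0$) in which each $\epsilon_i$ is nilpotent; here the basis may be taken over $\mathbb{R}$ or, for complexified unital nil algebras such as $\mathbb{C}\otimes_{\mathbb{R}}\mathbb{R}[\epsilon]/\langle\epsilon^2\rangle$, over $\mathbb{C}$. An algebra $\mathcal{A}$ is type-C if it is nonzero and $\mathcal{A}\cong\mathbb{C}\otimes_{\mathbb{R}}\mathcal{B}$ for some algebra $\mathcal{B}$. An algebra is type-R if it is not isomorphic to a direct product of an algebra $\mathcal{B}$ (possibly zero) and some type-C algebra $\mathcal{C}$. The complex portion of the algebra is the part of the decomposition made up of the type-C factors, that is, the copies of $\mathbb{C}$ and the complexified unital nil algebras.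
   Formalization: Type-C here also includes every unital nil algebra with a basis over C, even if it is not of the form C⊗B; with the literal definition part (1) fails for such algebras, which have period 2πi. Not every logarithm of A is claimed to be a product of Log on the real portion and a branch. *)

theory Defs
  imports "HOL-Analysis.Analysis"
begin

text \<open>
  An algebra lives on a linear subspace of some Euclidean space. This is fully general: a
  finite-dimensional real vector space is isomorphic to such a subspace, and its unique Hausdorff
  vector topology is the induced one. Addition, scalar multiplication and topology come from the
  ambient type; the inner product plays no role, and \<open>DIM('a)\<close> may exceed the dimension of
  the algebra. The zero algebra is the one with carrier \<open>{0}\<close>.
\<close>

record 'a alg =
  carr :: "'a set"
  mul :: "'a \<Rightarrow> 'a \<Rightarrow> 'a"
  uni :: "'a"

definition is_algebra :: "('a::euclidean_space) alg \<Rightarrow> bool" where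
  "is_algebra A \<longleftrightarrow>
     subspace (carr A) \<and> uni A \<in> carr A \<and>
     (\<forall>x\<in>carr A. \<forall>y\<in>carr A. mul A x y \<in> carr A \<and> mul A x y = mul A y x) \<and>
     (\<forall>x\<in>carr A. \<forall>y\<in>carr A. \<forall>z\<in>carr A.
        mul A (mul A x y) z = mul A x (mul A y z) \<and>
        mul A (x + y) z = mul A x z + mul A y z) \<and>
     (\<forall>c::real. \<forall>x\<in>carr A. \<forall>y\<in>carr A. mul A (c *\<^sub>R x) y = c *\<^sub>R mul A x y) \<and>
     (\<forall>x\<in>carr A. mul A (uni A) x = x)"

definition alg_hom ::
    "('a::euclidean_space) alg \<Rightarrow> ('b::euclidean_space) alg \<Rightarrow> ('a \<Rightarrow> 'b) \<Rightarrow> bool" where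
  "alg_hom A B f \<longleftrightarrow>
     (\<forall>x\<in>carr A. f x \<in> carr B) \<and>
     (\<forall>x\<in>carr A. \<forall>y\<in>carr A. f (x + y) = f x + f y \<and> f (mul A x y) = mul B (f x) (f y)) \<and>
     (\<forall>c::real. \<forall>x\<in>carr A. f (c *\<^sub>R x) = c *\<^sub>R f x) \<and>
     f (uni A) = uni B"

definition alg_iso :: "('a::euclidean_space) alg \<Rightarrow> ('b::euclidean_space) alg \<Rightarrow> bool" where
  "alg_iso A B \<longleftrightarrow> (\<exists>f. alg_hom A B f \<and> bij_betw f (carr A) (carr B))"

definition real_alg :: "real alg" where
  "real_alg = \<lparr>carr = UNIV, mul = (*), uni = 1\<rparr>"

definition complex_alg :: "complex alg" where
  "complex_alg = \<lparr>carr = UNIV, mul = (*), uni = 1\<rparr>"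

definition prod_alg ::
    "('a::euclidean_space) alg \<Rightarrow> ('b::euclidean_space) alg \<Rightarrow> ('a \<times> 'b) alg" where
  "prod_alg A B =
     \<lparr>carr = carr A \<times> carr B,
      mul = (\<lambda>x y. (mul A (fst x) (fst y), mul B (snd x) (snd y))),
      uni = (uni A, uni B)\<rparr>"

text \<open>
  \<open>complexification B\<close> is the tensor product of \<open>\<complex>\<close> and \<open>B\<close> over
  \<open>\<real>\<close>, where \<open>(x, y)\<close> stands for
  \<open>1 \<otimes> x + \<i> \<otimes> y\<close>.
\<close>

definition complexification :: "('a::euclidean_space) alg \<Rightarrow> ('a \<times> 'a) alg" where
  "complexification B =
     \<lparr>carr = carr B \<times> carr B,
      mul = (\<lambda>(x, y) (u, v). (mul B x u - mul B y v, mul B x v + mul B y u)),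
      uni = (uni B, 0)\<rparr>"

text \<open>
  A product of finitely many algebras is given by its projections: \<open>\<phi>\<close> is an isomorphism
  from \<open>A\<close> onto the product of the list \<open>Fs\<close>, with components \<open>\<phi> i\<close>.
\<close>

definition alg_decomposition ::
    "('a::euclidean_space) alg \<Rightarrow> ('b::euclidean_space) alg list \<Rightarrow> (nat \<Rightarrow> 'a \<Rightarrow> 'b) \<Rightarrow> bool" where
  "alg_decomposition A Fs \<phi> \<longleftrightarrow>
     (\<forall>i<length Fs. is_algebra (Fs ! i) \<and> alg_hom A (Fs ! i) (\<phi> i)) \<and>
     bij_betw (\<lambda>x. \<lambda>i\<in>{..<length Fs}. \<phi> i x) (carr A) (\<Pi>\<^sub>E i\<in>{..<length Fs}. carr (Fs ! i))"

primrec alg_power :: "'a alg \<Rightarrow> 'a \<Rightarrow> nat \<Rightarrow> 'a" where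
  "alg_power A z 0 = uni A"
| "alg_power A z (Suc k) = mul A z (alg_power A z k)"

definition alg_exp :: "('a::euclidean_space) alg \<Rightarrow> 'a \<Rightarrow> 'a" where
  "alg_exp A z = (\<Sum>k. (1 / fact k) *\<^sub>R alg_power A z k)"

definition Ld :: "('a::euclidean_space) alg \<Rightarrow> 'a set" where
  "Ld A = alg_exp A ` carr A"

text \<open>Functions with domain \<open>Ld A\<close> are extensional, so that they are counted correctly.\<close>

definition exp_inverse :: "('a::euclidean_space) alg \<Rightarrow> ('a \<Rightarrow> 'a) \<Rightarrow> bool" where
  "exp_inverse A l \<longleftrightarrow>
     l \<in> Ld A \<rightarrow>\<^sub>E carr A \<and>
     (\<forall>z\<in>carr A. l (alg_exp A z) = z) \<and>
     (\<forall>z\<in>Ld A. alg_exp A (l z) = z)"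

definition logarithms :: "('a::euclidean_space) alg \<Rightarrow> ('a set \<times> ('a \<Rightarrow> 'a)) set" where
  "logarithms A =
     {(B, l). B \<subseteq> carr A \<and> connected B \<and> inj_on (alg_exp A) B \<and> alg_exp A ` B = Ld A \<and>
        l \<in> Ld A \<rightarrow>\<^sub>E B \<and>
        (\<forall>z\<in>B. l (alg_exp A z) = z) \<and>
        (\<forall>z\<in>Ld A. alg_exp A (l z) = z)}"

definition multiplicative :: "('a::euclidean_space) alg \<Rightarrow> bool" where
  "multiplicative A \<longleftrightarrow>
     (\<exists>V. independent V \<and> span V = carr A \<and>
        (\<forall>u\<in>V. \<forall>v\<in>V. \<exists>c::real. \<exists>w\<in>V. mul A u v = c *\<^sub>R w))"

definition nilpotent_in :: "('a::euclidean_space) alg \<Rightarrow> 'a \<Rightarrow> bool" where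
  "nilpotent_in A x \<longleftrightarrow> x \<in> carr A \<and> (\<exists>k. alg_power A x k = 0)"

definition real_nil_algebra :: "('a::euclidean_space) alg \<Rightarrow> bool" where
  "real_nil_algebra A \<longleftrightarrow> is_algebra A \<and>
     (\<exists>E. uni A \<notin> E \<and> (\<forall>\<epsilon>\<in>E. nilpotent_in A \<epsilon>) \<and>
        independent (insert (uni A) E) \<and> span (insert (uni A) E) = carr A)"

text \<open>
  Here the basis is one over \<open>\<complex>\<close>. A structure of complex algebra on \<open>A\<close> extending
  the real one is an algebra homomorphism \<open>\<iota>\<close> from \<open>\<complex>\<close> to \<open>A\<close>, the scalar
  multiple of \<open>x\<close> by \<open>c\<close> being \<open>mul A (\<iota> c) x\<close>.
\<close>

definition complex_nil_algebra :: "('a::euclidean_space) alg \<Rightarrow> bool" where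
  "complex_nil_algebra A \<longleftrightarrow> is_algebra A \<and>
     (\<exists>\<iota> E. alg_hom complex_alg A \<iota> \<and>
        finite E \<and> uni A \<notin> E \<and> (\<forall>\<epsilon>\<in>E. nilpotent_in A \<epsilon>) \<and>
        (\<forall>x\<in>carr A. \<exists>!c. c \<in> insert (uni A) E \<rightarrow>\<^sub>E UNIV \<and>
           x = (\<Sum>b\<in>insert (uni A) E. mul A (\<iota> (c b)) b)))"

definition unital_nil_algebra :: "('a::euclidean_space) alg \<Rightarrow> bool" where
  "unital_nil_algebra A \<longleftrightarrow> real_nil_algebra A \<or> complex_nil_algebra A"

text \<open>
  In an isomorphism with a complexification or a product, the other algebras have at most the
  dimension of \<open>A\<close>, so letting them range over subspaces of the same type \<open>'a\<close> loses
  no generality.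

  Unital nil algebras over \<open>\<complex>\<close> count as type-C as well. The second disjunct is
  needed because such an algebra can fail to be the complexification of a real algebra (it need not be isomorphic to its
  complex conjugate) although it is multiplicative, indecomposable and has the nonzero period
  \<open>2 * pi * \<i>\<close> of its exponential.
\<close>

definition type_C :: "('a::euclidean_space) alg \<Rightarrow> bool" where
  "type_C A \<longleftrightarrow> is_algebra A \<and> carr A \<noteq> {0} \<and>
     ((\<exists>B::'a alg. is_algebra B \<and> alg_iso A (complexification B)) \<or> complex_nil_algebra A)"

definition type_R :: "('a::euclidean_space) alg \<Rightarrow> bool" where
  "type_R A \<longleftrightarrow>
     \<not> (\<exists>(B::'a alg) (C::'a alg). is_algebra B \<and> type_C C \<and> alg_iso A (prod_alg B C))"

definition nil_decomposition ::
    "('a::euclidean_space) alg \<Rightarrow> 'a alg list \<Rightarrow> 'a alg list \<Rightarrow> 'a alg list \<Rightarrow> (nat \<Rightarrow> 'a \<Rightarrow> 'a) \<Rightarrow> bool"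
  where
  "nil_decomposition A Ns Rs Cs \<phi> \<longleftrightarrow>
     (\<forall>N\<in>set Ns. unital_nil_algebra N) \<and>
     (\<forall>F\<in>set Rs. alg_iso F real_alg) \<and>
     (\<forall>F\<in>set Cs. alg_iso F complex_alg) \<and>
     alg_decomposition A (Ns @ Rs @ Cs) \<phi>"

text \<open>
  The product of the factors with index in \<open>J\<close>, realised inside \<open>A\<close> as an ideal. Its unit
  is an idempotent of \<open>A\<close>, and multiplication by it is the projection onto the ideal.
\<close>

definition portion ::
    "('a::euclidean_space) alg \<Rightarrow> 'a alg list \<Rightarrow> (nat \<Rightarrow> 'a \<Rightarrow> 'a) \<Rightarrow> nat set \<Rightarrow> 'a alg" where
  "portion A Fs \<phi> J =
     \<lparr>carr = {x \<in> carr A. \<forall>i<length Fs. i \<notin> J \<longrightarrow> \<phi> i x = 0},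
      mul = mul A,
      uni = (THE e. e \<in> carr A \<and>
               (\<forall>i<length Fs. \<phi> i e = (if i \<in> J then uni (Fs ! i) else 0)))\<rparr>"

definition complex_portion ::
    "('a::euclidean_space) alg \<Rightarrow> 'a alg list \<Rightarrow> (nat \<Rightarrow> 'a \<Rightarrow> 'a) \<Rightarrow> 'a alg" where
  "complex_portion A Fs \<phi> = portion A Fs \<phi> {i. i < length Fs \<and> type_C (Fs ! i)}"

definition real_portion ::
    "('a::euclidean_space) alg \<Rightarrow> 'a alg list \<Rightarrow> (nat \<Rightarrow> 'a \<Rightarrow> 'a) \<Rightarrow> 'a alg" where
  "real_portion A Fs \<phi> = portion A Fs \<phi> {i. i < length Fs \<and> \<not> type_C (Fs ! i)}"

definition proj :: "('a::euclidean_space) alg \<Rightarrow> 'a alg \<Rightarrow> 'a \<Rightarrow> 'a" where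
  "proj A P x = mul A (uni P) x"

definition lift_log ::
    "('a::euclidean_space) alg \<Rightarrow> 'a alg \<Rightarrow> 'a alg \<Rightarrow> ('a \<Rightarrow> 'a) \<Rightarrow>
     'a set \<times> ('a \<Rightarrow> 'a) \<Rightarrow> 'a set \<times> ('a \<Rightarrow> 'a)" where
  "lift_log A P Q L = (\<lambda>(B, l).
     ({x \<in> carr A. proj A Q x \<in> B}, \<lambda>z\<in>Ld A. L (proj A P z) + l (proj A Q z)))"

text \<open>
  The logarithms of \<open>A\<close>, internally the product of \<open>P\<close> and \<open>Q\<close>, are determined by
  the branches on \<open>Q\<close>. On \<open>P\<close> there is only one logarithm \<open>L\<close>; distinct
  branches on \<open>Q\<close> extend by \<open>L\<close> to distinct logarithms of \<open>A\<close>, and there are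
  infinitely many of them; and a logarithm of \<open>A\<close> is \<open>L\<close> on the \<open>P\<close>-component and
  inverts the exponential of \<open>Q\<close> on the \<open>Q\<close>-component. The latter component may vary with
  the \<open>P\<close>-component of the argument: for \<open>\<real> \<times> \<complex>\<close>, the sheared strip of all
  \<open>(t, s + \<i> * \<theta>)\<close> with \<open>t \<le> \<theta> < t + 2 * pi\<close> is the image of a logarithm.
\<close>

definition logs_determined_by ::
    "('a::euclidean_space) alg \<Rightarrow> 'a alg \<Rightarrow> 'a alg \<Rightarrow> bool" where
  "logs_determined_by A P Q \<longleftrightarrow>
     (\<exists>L. exp_inverse P L \<and>
        infinite (logarithms Q) \<and>
        lift_log A P Q L ` logarithms Q \<subseteq> logarithms A \<and>
        inj_on (lift_log A P Q L) (logarithms Q) \<and>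
        (\<forall>(B, l)\<in>logarithms A. \<forall>z\<in>Ld A.
           proj A P (l z) = L (proj A P z) \<and>
           alg_exp Q (proj A Q (l z)) = proj A Q z))"

end

theory Submission
  imports Defs "HOL-Computational_Algebra.Fundamental_Theorem_Algebra"
begin

text \<open>
  The logarithms of an algebra are governed by the periods of its exponential, the solutions of
  \<open>exp z = 1\<close>: since \<open>exp (x + y) = exp x * exp y\<close>, two elements have the same exponential iff they
  differ by a period. So the exponential is injective iff \<open>0\<close> is its only period, and then it has
  exactly one inverse.

  The algebra is split by orthogonal idempotents into corners that have no idempotents besides
  \<open>0\<close> and their unit (\<open>idempotent_splitting\<close>). In such a corner each element is nilpotent or invertible. The
  value of a suitable real polynomial of degree two, the minimal polynomial of a complex number or the
  square of a linear one, is therefore nilpotent at each element. If these polynomials can always be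
  taken with a real root, each element is a real scalar plus a nilpotent one. Otherwise some element
  squares to \<open>-1\<close> up to nilpotents; Newton's iteration improves it to a genuine square root of \<open>-1\<close>,
  the corner becomes an algebra over \<open>\<complex>\<close>, and each element is a complex scalar plus a nilpotent one
  (\<open>connected_imp_unital_nil_algebra\<close>). In both cases the corner is a unital nil algebra.

  For \<open>n\<close> nilpotent, \<open>exp n = 1\<close> forces \<open>n = 0\<close>, and scalars can be separated from nilpotents. Hence a
  real unital nil algebra has no nonzero period, and the periods of a complex one are the multiples
  \<open>2 * pi * \<i> * k\<close> of the unit. A type-C algebra contains a copy of \<open>\<complex>\<close> with the same unit and so has
  nonzero periods. It follows that type-R algebras are exactly those whose exponential has no nonzero
  period.

  For an algebra that is not type-R, let \<open>e\<close> be the unit of the complex portion. The exponential acts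
  componentwise on \<open>x = (1 - e) x + e x\<close> and is injective on the first component, the real portion.
  This makes each logarithm the unique one on the real portion and turns a branch on the complex
  portion into a logarithm of the algebra (\<open>logs_determined_by_corner\<close>). On the complex portion the
  periods form a lattice with respect to the imaginary parts of the components, and a half-open cube
  with edges of length \<open>2 * pi\<close> in these coordinates is the image of a logarithm; there are infinitely
  many such cubes (\<open>infinite_logarithms\<close>).
\<close>

section \<open>Calculus in an algebra\<close>

locale fd_algebra =
  fixes A :: "('a::euclidean_space) alg"
  assumes is_algebra: "is_algebra A"
begin

abbreviation pr (infixl "\<odot>" 70) where "x \<odot> y \<equiv> mul A x y"
abbreviation un ("\<one>") where "\<one> \<equiv> uni A"
abbreviation pw where "pw \<equiv> alg_power A"
abbreviation nil where "nil \<equiv> nilpotent_in A"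

lemma subspace_carr: "subspace (carr A)"
  using is_algebra by (simp add: is_algebra_def)

lemma carr_closed [simp]:
  "0 \<in> carr A" "\<one> \<in> carr A"
  "x \<in> carr A \<Longrightarrow> y \<in> carr A \<Longrightarrow> x \<odot> y \<in> carr A"
  "x \<in> carr A \<Longrightarrow> y \<in> carr A \<Longrightarrow> x + y \<in> carr A"
  "x \<in> carr A \<Longrightarrow> y \<in> carr A \<Longrightarrow> x - y \<in> carr A"
  "x \<in> carr A \<Longrightarrow> - x \<in> carr A"
  "x \<in> carr A \<Longrightarrow> c *\<^sub>R x \<in> carr A"
  using is_algebra subspace_carr
  by (auto simp: is_algebra_def intro: subspace_add subspace_diff subspace_neg subspace_scale
      subspace_0)

lemma sum_closed [simp]: "(\<And>i. i \<in> I \<Longrightarrow> f i \<in> carr A) \<Longrightarrow> sum f I \<in> carr A"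
  by (rule subspace_sum[OF subspace_carr])

lemma mul_comm: "x \<in> carr A \<Longrightarrow> y \<in> carr A \<Longrightarrow> x \<odot> y = y \<odot> x"
  using is_algebra unfolding is_algebra_def by blast

lemma mul_assoc:
  "x \<in> carr A \<Longrightarrow> y \<in> carr A \<Longrightarrow> z \<in> carr A \<Longrightarrow> x \<odot> y \<odot> z = x \<odot> (y \<odot> z)"
  using is_algebra unfolding is_algebra_def by blast

lemma mul_lcomm:
  "x \<in> carr A \<Longrightarrow> y \<in> carr A \<Longrightarrow> z \<in> carr A \<Longrightarrow> x \<odot> (y \<odot> z) = y \<odot> (x \<odot> z)"
  by (metis mul_comm mul_assoc)

lemmas mul_ac = mul_comm mul_assoc mul_lcomm

lemma mul_unit [simp]: "x \<in> carr A \<Longrightarrow> \<one> \<odot> x = x" "x \<in> carr A \<Longrightarrow> x \<odot> \<one> = x"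
  using is_algebra mul_comm[of x \<one>] by (auto simp: is_algebra_def)

lemma mul_add_left:
  "x \<in> carr A \<Longrightarrow> y \<in> carr A \<Longrightarrow> z \<in> carr A \<Longrightarrow> (x + y) \<odot> z = x \<odot> z + y \<odot> z"
  using is_algebra unfolding is_algebra_def by blast

lemma mul_add_right:
  "x \<in> carr A \<Longrightarrow> y \<in> carr A \<Longrightarrow> z \<in> carr A \<Longrightarrow> z \<odot> (x + y) = z \<odot> x + z \<odot> y"
  by (simp add: mul_comm[of z] mul_add_left)

lemma mul_scale_left [simp]:
  "x \<in> carr A \<Longrightarrow> y \<in> carr A \<Longrightarrow> (c *\<^sub>R x) \<odot> y = c *\<^sub>R (x \<odot> y)"
  using is_algebra unfolding is_algebra_def by blast

lemma mul_scale_right [simp]: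
  "x \<in> carr A \<Longrightarrow> y \<in> carr A \<Longrightarrow> x \<odot> (c *\<^sub>R y) = c *\<^sub>R (x \<odot> y)"
  by (simp add: mul_comm[of x])

lemma mul_zero [simp]: "x \<in> carr A \<Longrightarrow> 0 \<odot> x = 0" "x \<in> carr A \<Longrightarrow> x \<odot> 0 = 0"
  using mul_scale_left[of 0 x 0] mul_scale_right[of x 0 0] by auto

lemma mul_minus [simp]:
  "x \<in> carr A \<Longrightarrow> y \<in> carr A \<Longrightarrow> (- x) \<odot> y = - (x \<odot> y)"
  "x \<in> carr A \<Longrightarrow> y \<in> carr A \<Longrightarrow> x \<odot> (- y) = - (x \<odot> y)"
  using mul_scale_left[of x y "-1"] mul_scale_right[of x y "-1"] by auto

lemma mul_diff_left:
  "x \<in> carr A \<Longrightarrow> y \<in> carr A \<Longrightarrow> z \<in> carr A \<Longrightarrow> (x - y) \<odot> z = x \<odot> z - y \<odot> z"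
  using mul_add_left[of x "- y" z] by simp

lemma mul_diff_right:
  "x \<in> carr A \<Longrightarrow> y \<in> carr A \<Longrightarrow> z \<in> carr A \<Longrightarrow> z \<odot> (x - y) = z \<odot> x - z \<odot> y"
  using mul_add_right[of x "- y" z] by simp

lemmas mul_distribs = mul_add_left mul_add_right mul_diff_left mul_diff_right

lemma mul_sum_right:
  "x \<in> carr A \<Longrightarrow> (\<And>i. i \<in> I \<Longrightarrow> f i \<in> carr A) \<Longrightarrow> x \<odot> sum f I = (\<Sum>i\<in>I. x \<odot> f i)"
  by (induction I rule: infinite_finite_induct) (simp_all add: mul_add_right)

lemma mul_sum_left:
  "x \<in> carr A \<Longrightarrow> (\<And>i. i \<in> I \<Longrightarrow> f i \<in> carr A) \<Longrightarrow> sum f I \<odot> x = (\<Sum>i\<in>I. f i \<odot> x)"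
  by (induction I rule: infinite_finite_induct) (simp_all add: mul_add_left)

lemma pw_closed [simp]: "x \<in> carr A \<Longrightarrow> pw x k \<in> carr A"
  by (induction k) simp_all

lemma pw_add: "x \<in> carr A \<Longrightarrow> pw x (k + l) = pw x k \<odot> pw x l"
  by (induction k) (simp_all add: mul_ac)

lemma pw_mul: "x \<in> carr A \<Longrightarrow> y \<in> carr A \<Longrightarrow> pw (x \<odot> y) k = pw x k \<odot> pw y k"
  by (induction k) (simp_all add: mul_ac)

lemma pw_eq_0_mono: "x \<in> carr A \<Longrightarrow> pw x k = 0 \<Longrightarrow> k \<le> l \<Longrightarrow> pw x l = 0"
  by (metis le_add_diff_inverse pw_add mul_zero(1) pw_closed)

lemma pw_unit [simp]: "pw \<one> k = \<one>"
  by (induction k) simp_all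

lemma pw_zero: "k > 0 \<Longrightarrow> pw 0 k = 0"
  by (cases k) simp_all

lemma unit_zero_trivial: "\<one> = 0 \<Longrightarrow> x \<in> carr A \<Longrightarrow> x = 0"
  by (metis mul_unit(1) mul_zero(1))

lemma nontrivial: "carr A \<noteq> {0} \<longleftrightarrow> \<one> \<noteq> 0"
  using unit_zero_trivial carr_closed(1,2) by blast

text \<open>
  Multiplication is only specified on the carrier. Composing it with a linear projection onto the
  carrier extends it to a bilinear map on the ambient space, which is bounded in finite dimension.
\<close>

lemma bilinear_extension:
  obtains m where "bounded_bilinear m" "\<And>x y. x \<in> carr A \<Longrightarrow> y \<in> carr A \<Longrightarrow> m x y = x \<odot> y"
proof -
  obtain P :: "'a \<Rightarrow> 'a" where P: "range P \<subseteq> carr A" "linear P" "\<And>v. v \<in> carr A \<Longrightarrow> P v = v"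
    using real_vector.linear_exists_left_inverse_on[OF linear_id subspace_carr] by auto
  have Pc [simp]: "P x \<in> carr A" for x
    using P(1) by auto
  have "bilinear (\<lambda>x y. P x \<odot> P y)"
    unfolding bilinear_def
    by (auto intro!: linearI simp: linear_add[OF P(2)] linear_scale[OF P(2)] mul_distribs)
  then show thesis
    using that[of "\<lambda>x y. P x \<odot> P y"] by (simp add: bilinear_conv_bounded_bilinear P(3))
qed

end

section \<open>Homomorphisms\<close>

lemma alg_homD:
  assumes "alg_hom A B f" "x \<in> carr A"
  shows "f x \<in> carr B"
    and "y \<in> carr A \<Longrightarrow> f (x + y) = f x + f y"
    and "y \<in> carr A \<Longrightarrow> f (mul A x y) = mul B (f x) (f y)"
    and "f (c *\<^sub>R x) = c *\<^sub>R f x"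
    and "f (uni A) = uni B"
  using assms by (auto simp: alg_hom_def)

context
  fixes A :: "('a::euclidean_space) alg" and B :: "('b::euclidean_space) alg" and f
  assumes A: "is_algebra A" and B: "is_algebra B" and f: "alg_hom A B f"
begin

interpretation A: fd_algebra A by unfold_locales (rule A)
interpretation B: fd_algebra B by unfold_locales (rule B)

lemma hom_0: "f 0 = 0"
  using alg_homD(4)[OF f, of 0 0] by simp

lemma hom_minus: "x \<in> carr A \<Longrightarrow> f (- x) = - f x"
  using alg_homD(4)[OF f, of x "-1"] by simp

lemma hom_diff: "x \<in> carr A \<Longrightarrow> y \<in> carr A \<Longrightarrow> f (x - y) = f x - f y"
  using alg_homD(2)[OF f, of x "- y"] by (simp add: hom_minus)

lemma hom_power: "x \<in> carr A \<Longrightarrow> f (alg_power A x k) = alg_power B (f x) k"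
  by (induction k) (simp_all add: alg_homD[OF f] alg_homD(5)[OF f A.carr_closed(1)])

lemma hom_extension:
  obtains g where "bounded_linear g" "\<And>x. x \<in> carr A \<Longrightarrow> g x = f x"
proof -
  obtain P :: "'a \<Rightarrow> 'a" where P: "range P \<subseteq> carr A" "linear P" "\<And>v. v \<in> carr A \<Longrightarrow> P v = v"
    using real_vector.linear_exists_left_inverse_on[OF linear_id A.subspace_carr] by auto
  have Pc [simp]: "P x \<in> carr A" for x
    using P(1) by auto
  have "linear (\<lambda>x. f (P x))"
    by (rule linearI) (simp_all add: linear_add[OF P(2)] linear_scale[OF P(2)] alg_homD[OF f])
  then show thesis
    using that[of "\<lambda>x. f (P x)"] by (simp add: linear_conv_bounded_linear P(3))
qed

end

lemma alg_hom_comp: "alg_hom A B f \<Longrightarrow> alg_hom B C g \<Longrightarrow> alg_hom A C (g \<circ> f)"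
  by (simp add: alg_hom_def)

lemma alg_hom_inverse:
  assumes A: "is_algebra A" and f: "alg_hom A B f" and bij: "bij_betw f (carr A) (carr B)"
  shows "alg_hom B A (inv_into (carr A) f)"
proof -
  interpret fd_algebra A by unfold_locales (rule A)
  let ?g = "inv_into (carr A) f"
  have g: "?g y \<in> carr A" "f (?g y) = y" if "y \<in> carr B" for y
    using that bij by (metis bij_betw_imp_surj_on inv_into_into, metis bij_betw_inv_into_right)
  have gf: "?g (f x) = x" if "x \<in> carr A" for x
    using that bij by (simp add: bij_betw_inv_into_left)
  have "?g (x + y) = ?g x + ?g y" "?g (mul B x y) = mul A (?g x) (?g y)"
    if "x \<in> carr B" "y \<in> carr B" for x y
    using gf[of "?g x + ?g y"] gf[of "mul A (?g x) (?g y)"] that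
    by (simp_all add: g alg_homD[OF f])
  moreover have "?g (c *\<^sub>R x) = c *\<^sub>R ?g x" if "x \<in> carr B" for c x
    using gf[of "c *\<^sub>R ?g x"] that by (simp add: g alg_homD[OF f])
  moreover have "?g (uni B) = uni A"
    using gf[of "uni A"] alg_homD(5)[OF f, of 0] by simp
  ultimately show ?thesis
    by (simp add: alg_hom_def g)
qed

lemma is_algebra_real: "is_algebra real_alg"
  by (simp add: is_algebra_def real_alg_def algebra_simps)

lemma is_algebra_complex: "is_algebra complex_alg"
  by (simp add: is_algebra_def complex_alg_def algebra_simps)

lemma alg_power_real: "alg_power real_alg x k = x ^ k"
  by (induction k) (simp_all add: real_alg_def)

lemma alg_power_complex: "alg_power complex_alg x k = x ^ k"
  by (induction k) (simp_all add: complex_alg_def)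

lemma alg_exp_real: "alg_exp real_alg x = exp x"
  by (simp add: alg_exp_def alg_power_real exp_def divide_inverse)

lemma alg_exp_complex: "alg_exp complex_alg z = exp z"
  by (simp add: alg_exp_def alg_power_complex exp_def divide_inverse)

section \<open>The exponential\<close>

text \<open>
  Bilinear maps on Euclidean spaces are combinations of products of coordinates, so the Cauchy
  product formula follows from the one for real series.
\<close>

lemma bilinear_Cauchy_product_sums:
  fixes m :: "'a::euclidean_space \<Rightarrow> 'a \<Rightarrow> 'a"
  assumes m: "bounded_bilinear m"
    and a: "summable (\<lambda>k. norm (a k))" and b: "summable (\<lambda>k. norm (b k))"
  shows "(\<lambda>n. \<Sum>i\<le>n. m (a i) (b (n - i))) sums m (\<Sum>k. a k) (\<Sum>k. b k)"
proof -
  interpret bounded_bilinear m by fact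
  have expand: "m x y = (\<Sum>u\<in>Basis. \<Sum>v\<in>Basis. ((x \<bullet> u) * (y \<bullet> v)) *\<^sub>R m u v)" for x y
  proof -
    have "m x y = m (\<Sum>u\<in>Basis. (x \<bullet> u) *\<^sub>R u) (\<Sum>v\<in>Basis. (y \<bullet> v) *\<^sub>R v)"
      by (simp only: euclidean_representation)
    then show ?thesis
      by (subst sum.swap) (simp add: sum_left sum_right scaleR_left scaleR_right scaleR_sum_right
          mult.commute del: euclidean_representation)
  qed
  have coord: "summable (\<lambda>k. norm (f k \<bullet> u))" if "summable (\<lambda>k. norm (f k))" "u \<in> Basis"
    for f :: "nat \<Rightarrow> 'a" and u
    using that(1) by (rule summable_comparison_test') (simp add: Basis_le_norm that(2))
  have inner: "(\<Sum>k. f k \<bullet> u) = (\<Sum>k. f k) \<bullet> u" if "summable (\<lambda>k. norm (f k))"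
    for f :: "nat \<Rightarrow> 'a" and u
    using bounded_linear.suminf[OF bounded_linear_inner_left summable_norm_cancel[OF that]] by simp
  have "(\<lambda>n. \<Sum>i\<le>n. (a i \<bullet> u) * (b (n - i) \<bullet> v)) sums (((\<Sum>k. a k) \<bullet> u) * ((\<Sum>k. b k) \<bullet> v))"
    if "u \<in> Basis" "v \<in> Basis" for u v
    using Cauchy_product_sums[OF coord[OF a that(1)] coord[OF b that(2)]]
    by (simp add: inner a b)
  then have "(\<lambda>n. \<Sum>u\<in>Basis. \<Sum>v\<in>Basis. (\<Sum>i\<le>n. (a i \<bullet> u) * (b (n - i) \<bullet> v)) *\<^sub>R m u v) sums
     (\<Sum>u\<in>Basis. \<Sum>v\<in>Basis. (((\<Sum>k. a k) \<bullet> u) * ((\<Sum>k. b k) \<bullet> v)) *\<^sub>R m u v)"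
    by (intro sums_sum sums_scaleR_left)
  moreover have "(\<Sum>u\<in>Basis. \<Sum>v\<in>Basis. (\<Sum>i\<le>n. (a i \<bullet> u) * (b (n - i) \<bullet> v)) *\<^sub>R m u v) =
      (\<Sum>i\<le>n. m (a i) (b (n - i)))" for n
  proof -
    have "(\<Sum>i\<le>n. m (a i) (b (n - i))) =
        (\<Sum>i\<le>n. \<Sum>u\<in>Basis. \<Sum>v\<in>Basis. ((a i \<bullet> u) * (b (n - i) \<bullet> v)) *\<^sub>R m u v)"
      by (subst expand) simp
    also have "\<dots> = (\<Sum>u\<in>Basis. \<Sum>i\<le>n. \<Sum>v\<in>Basis. ((a i \<bullet> u) * (b (n - i) \<bullet> v)) *\<^sub>R m u v)"
      by (rule sum.swap)
    also have "\<dots> = (\<Sum>u\<in>Basis. \<Sum>v\<in>Basis. \<Sum>i\<le>n. ((a i \<bullet> u) * (b (n - i) \<bullet> v)) *\<^sub>R m u v)"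
      by (intro sum.cong refl sum.swap)
    finally show ?thesis
      by (simp add: scaleR_sum_left)
  qed
  ultimately show ?thesis
    by (simp flip: expand)
qed

context fd_algebra
begin

definition divided_power :: "'a \<Rightarrow> nat \<Rightarrow> 'a" where "divided_power x k = (1 / fact k) *\<^sub>R pw x k"

lemma divided_power_closed [simp]: "x \<in> carr A \<Longrightarrow> divided_power x k \<in> carr A"
  by (simp add: divided_power_def)

lemma alg_exp_divided_power: "alg_exp A x = (\<Sum>k. divided_power x k)"
  by (simp add: alg_exp_def divided_power_def)

lemma summable_norm_divided_power:
  assumes x: "x \<in> carr A"
  shows "summable (\<lambda>k. norm (divided_power x k))"
proof -
  obtain m where m: "bounded_bilinear m" "\<And>x y. x \<in> carr A \<Longrightarrow> y \<in> carr A \<Longrightarrow> m x y = x \<odot> y"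
    by (rule bilinear_extension) blast
  obtain K where K: "K > 0" "\<And>a b. norm (m a b) \<le> norm a * norm b * K"
    using bounded_bilinear.pos_bounded[OF m(1)] by blast
  have bound: "norm (pw x k) \<le> norm \<one> * (norm x * K) ^ k" for k
  proof (induction k)
    case (Suc k)
    have "norm (pw x (Suc k)) \<le> norm x * norm (pw x k) * K"
      using K(2)[of x "pw x k"] x by (simp add: m(2))
    also have "\<dots> \<le> norm x * (norm \<one> * (norm x * K) ^ k) * K"
      using Suc K(1) by (intro mult_right_mono mult_left_mono) auto
    finally show ?case by (simp add: algebra_simps)
  qed simp
  have "norm (norm (divided_power x k)) \<le> norm \<one> * (inverse (fact k) * (norm x * K) ^ k)" for k
    using mult_left_mono[OF bound[of k], of "inverse (fact k)"]
    by (simp add: divided_power_def divide_inverse algebra_simps)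
  then show ?thesis
    by (intro summable_comparison_test'[OF summable_mult[OF summable_exp[of "norm x * K"]]])
qed

lemma summable_divided_power: "x \<in> carr A \<Longrightarrow> summable (divided_power x)"
  by (rule summable_norm_cancel[OF summable_norm_divided_power])

lemma exp_closed [simp]: "x \<in> carr A \<Longrightarrow> alg_exp A x \<in> carr A"
proof -
  assume x: "x \<in> carr A"
  have "(\<lambda>n. \<Sum>k<n. divided_power x k) \<longlonglongrightarrow> alg_exp A x"
    using summable_LIMSEQ[OF summable_divided_power[OF x]] by (simp add: alg_exp_divided_power)
  then show ?thesis
    by (rule closed_sequentially[OF closed_subspace[OF subspace_carr], rotated]) (simp add: x)
qed

text \<open>
  The binomial formula, in the form needed for the Cauchy product of two exponential series.
\<close>

lemma divided_power_add:
  assumes x: "x \<in> carr A" and y: "y \<in> carr A"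
  shows "divided_power (x + y) n = (\<Sum>i\<le>n. divided_power x i \<odot> divided_power y (n - i))"
proof (induction n)
  case 0
  show ?case by (simp add: divided_power_def)
next
  case (Suc n)
  let ?S = "\<lambda>i j. divided_power x i \<odot> divided_power y j"
  have step: "z \<odot> divided_power z k = real (Suc k) *\<^sub>R divided_power z (Suc k)" if "z \<in> carr A" for z k
    using that by (simp add: divided_power_def del: of_nat_Suc)
  have "real (Suc n) *\<^sub>R divided_power (x + y) (Suc n) = (x + y) \<odot> (\<Sum>i\<le>n. ?S i (n - i))"
    using step[of "x + y" n] x y by (simp add: Suc)
  also have "\<dots> = (\<Sum>i\<le>n. (x \<odot> divided_power x i) \<odot> divided_power y (n - i)) + (\<Sum>i\<le>n. divided_power x i \<odot> (y \<odot> divided_power y (n - i)))"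
    using x y by (simp add: mul_add_left mul_sum_right mul_ac sum.distrib)
  also have "\<dots> = (\<Sum>i\<le>n. real (Suc i) *\<^sub>R ?S (Suc i) (n - i)) +
      (\<Sum>i\<le>n. real (Suc n - i) *\<^sub>R ?S i (Suc n - i))"
    using x y by (simp add: step Suc_diff_le del: of_nat_Suc)
  also have "(\<Sum>i\<le>n. real (Suc i) *\<^sub>R ?S (Suc i) (n - i)) = (\<Sum>i\<le>Suc n. real i *\<^sub>R ?S i (Suc n - i))"
    by (subst sum.atMost_Suc_shift) simp
  also have "(\<Sum>i\<le>n. real (Suc n - i) *\<^sub>R ?S i (Suc n - i)) =
      (\<Sum>i\<le>Suc n. real (Suc n - i) *\<^sub>R ?S i (Suc n - i))"
    by simp
  also have "(\<Sum>i\<le>Suc n. real i *\<^sub>R ?S i (Suc n - i)) + \<dots> =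
      (\<Sum>i\<le>Suc n. real (Suc n) *\<^sub>R ?S i (Suc n - i))"
    by (simp flip: sum.distrib scaleR_add_left of_nat_add)
  also have "\<dots> = real (Suc n) *\<^sub>R (\<Sum>i\<le>Suc n. ?S i (Suc n - i))"
    by (simp only: scaleR_right.sum)
  finally show ?case
    by (simp del: sum.cl_ivl_Suc)
qed

lemma exp_add:
  assumes x: "x \<in> carr A" and y: "y \<in> carr A"
  shows "alg_exp A (x + y) = alg_exp A x \<odot> alg_exp A y"
proof -
  obtain m where m: "bounded_bilinear m" "\<And>x y. x \<in> carr A \<Longrightarrow> y \<in> carr A \<Longrightarrow> m x y = x \<odot> y"
    by (rule bilinear_extension) blast
  have "(\<lambda>n. divided_power (x + y) n) sums m (alg_exp A x) (alg_exp A y)"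
    using bilinear_Cauchy_product_sums[OF m(1) summable_norm_divided_power[OF x] summable_norm_divided_power[OF y]]
    by (simp add: m(2) x y divided_power_add alg_exp_divided_power)
  then show ?thesis
    by (simp add: m(2) x y alg_exp_divided_power[symmetric] sums_iff)
qed

lemma exp_0 [simp]: "alg_exp A 0 = \<one>"
proof -
  have "divided_power 0 k = (if k = 0 then \<one> else 0)" for k
    by (simp add: divided_power_def pw_zero)
  then have "(\<Sum>k. divided_power 0 k) = (\<Sum>k\<in>{0}. divided_power 0 k)"
    by (intro suminf_finite) auto
  then show ?thesis
    by (simp add: alg_exp_divided_power divided_power_def)
qed

lemma exp_eq_iff:
  assumes x: "x \<in> carr A" and y: "y \<in> carr A"
  shows "alg_exp A x = alg_exp A y \<longleftrightarrow> alg_exp A (x - y) = \<one>"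
proof -
  have "alg_exp A x = alg_exp A (x - y) \<odot> alg_exp A y" "alg_exp A (x - y) = alg_exp A x \<odot> alg_exp A (- y)"
    "alg_exp A y \<odot> alg_exp A (- y) = \<one>"
    using exp_add[of "x - y" y] exp_add[of x "- y"] exp_add[of y "- y"] x y by simp_all
  then show ?thesis
    using y by auto
qed

lemma exp_inj_iff: "inj_on (alg_exp A) (carr A) \<longleftrightarrow> (\<forall>z\<in>carr A. alg_exp A z = \<one> \<longrightarrow> z = 0)"
  unfolding inj_on_def by (metis carr_closed(1,5) exp_0 exp_eq_iff diff_zero right_minus_eq)

end

text \<open>
  A homomorphism is linear, hence continuous in finite dimension, and so may be applied to the
  exponential series termwise. Most questions about the exponential are transported along
  homomorphisms by this lemma.
\<close>

lemma hom_exp: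
  assumes A: "is_algebra A" and B: "is_algebra B" and f: "alg_hom A B f" and x: "x \<in> carr A"
  shows "f (alg_exp A x) = alg_exp B (f x)"
proof -
  interpret A: fd_algebra A by unfold_locales (rule A)
  interpret B: fd_algebra B by unfold_locales (rule B)
  obtain g where g: "bounded_linear g" "\<And>x. x \<in> carr A \<Longrightarrow> g x = f x"
    by (rule hom_extension[OF A B f]) blast
  have "f (alg_exp A x) = g (\<Sum>k. A.divided_power x k)"
    using x by (simp add: g(2) flip: A.alg_exp_divided_power)
  also have "\<dots> = (\<Sum>k. g (A.divided_power x k))"
    by (rule bounded_linear.suminf[OF g(1) A.summable_divided_power[OF x]])
  also have "\<dots> = (\<Sum>k. B.divided_power (f x) k)"
    by (simp add: g(2) x A.divided_power_def B.divided_power_def alg_homD[OF f] hom_power[OF A B f])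
  finally show ?thesis
    by (simp add: B.alg_exp_divided_power)
qed

section \<open>Nilpotent elements\<close>

context fd_algebra
begin

lemma nil_closed: "nil x \<Longrightarrow> x \<in> carr A"
  by (simp add: nilpotent_in_def)

lemma nilI: "x \<in> carr A \<Longrightarrow> pw x k = 0 \<Longrightarrow> nil x"
  by (auto simp: nilpotent_in_def)

lemma nil_0 [simp]: "nil 0"
  by (rule nilI[of _ 1]) simp_all

lemma nil_mul: "nil x \<Longrightarrow> y \<in> carr A \<Longrightarrow> nil (x \<odot> y)"
  unfolding nilpotent_in_def by (metis carr_closed(3) mul_zero(1) pw_closed pw_mul)

lemma nil_mul': "nil x \<Longrightarrow> y \<in> carr A \<Longrightarrow> nil (y \<odot> x)"
  using nil_mul[of x y] by (simp add: mul_comm nil_closed)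

lemma nil_scale: "nil x \<Longrightarrow> nil (c *\<^sub>R x)"
  using nil_mul[of x "c *\<^sub>R \<one>"] by (simp add: nil_closed)

lemma nil_minus: "nil x \<Longrightarrow> nil (- x)"
  using nil_scale[of x "-1"] by simp

text \<open>
  Induction on \<open>k + l\<close>, with an auxiliary factor \<open>z\<close>, replaces the binomial formula: multiplying
  \<open>z\<close> by \<open>x\<close> lowers \<open>k\<close> and multiplying it by \<open>y\<close> lowers \<open>l\<close>.
\<close>

lemma pw_add_eq_0:
  assumes x: "x \<in> carr A" and y: "y \<in> carr A" and "z \<in> carr A"
    and "pw x k \<odot> z = 0" "pw y l \<odot> z = 0"
  shows "\<exists>n. pw (x + y) n \<odot> z = 0"
  using assms(3-)
proof (induction "k + l" arbitrary: k l z rule: less_induct)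
  case less
  show ?case
  proof (cases "k = 0 \<or> l = 0")
    case True
    then have "z = 0" using less.prems by auto
    then show ?thesis using x y by auto
  next
    case False
    then obtain k' l' where kl: "k = Suc k'" "l = Suc l'"
      by (metis not0_implies_Suc)
    have shift: "pw u i \<odot> (u \<odot> w) = pw u (Suc i) \<odot> w"
      and swap: "pw v i \<odot> (u \<odot> w) = u \<odot> (pw v i \<odot> w)"
      if "u \<in> carr A" "v \<in> carr A" "w \<in> carr A" for u v w i
      using that by (simp_all add: mul_ac)
    obtain n1 where n1: "pw (x + y) n1 \<odot> (x \<odot> z) = 0"
      using less.hyps[of k' l "x \<odot> z"] less.prems x y kl shift[of x x z k'] swap[of x y z l] by auto
    obtain n2 where n2: "pw (x + y) n2 \<odot> (y \<odot> z) = 0"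
      using less.hyps[of k l' "y \<odot> z"] less.prems x y kl shift[of y y z l'] swap[of y x z k] by auto
    let ?n = "n1 + n2"
    have "pw (x + y) ?n \<odot> (x \<odot> z) = pw (x + y) n2 \<odot> (pw (x + y) n1 \<odot> (x \<odot> z))"
      "pw (x + y) ?n \<odot> (y \<odot> z) = pw (x + y) n1 \<odot> (pw (x + y) n2 \<odot> (y \<odot> z))"
      using x y less.prems by (simp_all add: pw_add mul_ac)
    then have "pw (x + y) ?n \<odot> (x \<odot> z) + pw (x + y) ?n \<odot> (y \<odot> z) = 0"
      using n1 n2 x y by simp
    moreover have "pw (x + y) (Suc ?n) \<odot> z = pw (x + y) ?n \<odot> ((x + y) \<odot> z)"
      using x y less.prems(1) by (simp add: mul_ac)
    ultimately have "pw (x + y) (Suc ?n) \<odot> z = 0"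
      using x y less.prems(1) by (simp only: mul_distribs carr_closed pw_closed)
    then show ?thesis by blast
  qed
qed

lemma nil_add:
  assumes "nil x" "nil y"
  shows "nil (x + y)"
proof -
  obtain k l where "pw x k = 0" "pw y l = 0" and xy: "x \<in> carr A" "y \<in> carr A"
    using assms by (auto simp: nilpotent_in_def)
  then obtain n where "pw (x + y) n \<odot> \<one> = 0"
    using pw_add_eq_0[of x y \<one> k l] by auto
  then show ?thesis
    using xy by (intro nilI[of _ n]) simp_all
qed

lemma nil_diff: "nil x \<Longrightarrow> nil y \<Longrightarrow> nil (x - y)"
  using nil_add[of x "- y"] nil_minus[of y] by simp

lemma nil_sum: "(\<And>i. i \<in> I \<Longrightarrow> nil (f i)) \<Longrightarrow> nil (sum f I)"
  by (induction I rule: infinite_finite_induct) (simp_all add: nil_add)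

lemma subspace_nil: "subspace {x. nil x}"
  by (rule subspaceI) (simp_all add: nil_add nil_scale)

lemma nil_unit: "nil \<one> \<Longrightarrow> \<one> = 0"
  by (auto simp: nilpotent_in_def)

lemma nil_scaled_unit: "nil (c *\<^sub>R \<one>) \<Longrightarrow> \<one> \<noteq> 0 \<Longrightarrow> c = 0"
  using nil_scale[of "c *\<^sub>R \<one>" "1 / c"] nil_unit by (cases "c = 0") auto

lemma nil_square: "x \<in> carr A \<Longrightarrow> nil (x \<odot> x) \<Longrightarrow> nil x"
  by (auto simp: nilpotent_in_def pw_mul simp flip: pw_add)

text \<open>
  Iterating, \<open>x = x * y ^ k\<close> for all \<open>k\<close>.
\<close>

lemma eq_mul_nil_imp_0:
  assumes x: "x \<in> carr A" and y: "nil y" and eq: "x \<odot> y = x"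
  shows "x = 0"
proof -
  note yc = nil_closed[OF y]
  have absorb: "x \<odot> pw y k = x" for k
  proof (induction k)
    case (Suc k)
    have "x \<odot> pw y (Suc k) = (x \<odot> y) \<odot> pw y k"
      using x yc by (simp add: mul_assoc)
    then show ?case
      using eq Suc by simp
  qed (simp add: x)
  obtain k where "pw y k = 0"
    using y by (auto simp: nilpotent_in_def)
  then show ?thesis
    using absorb[of k] x by simp
qed

text \<open>
  All terms of the exponential series but the first two lie in the ideal generated by \<open>x\<^sup>2\<close>, which as
  a subspace of finite dimension is closed and so contains their sum.
\<close>

lemma exp_expansion:
  assumes x: "x \<in> carr A"
  obtains v where "v \<in> carr A" "alg_exp A x = \<one> + x + x \<odot> x \<odot> v"
proof -
  let ?V = "(\<lambda>v. x \<odot> x \<odot> v) ` carr A"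
  have "subspace ?V"
  proof (rule subspaceI)
    show "0 \<in> ?V" using x by (intro image_eqI[of _ _ 0]) simp_all
    fix u assume "u \<in> ?V"
    then obtain u' where u: "u' \<in> carr A" "u = x \<odot> x \<odot> u'" by blast
    show "c *\<^sub>R u \<in> ?V" for c
      using u x by (intro image_eqI[of _ _ "c *\<^sub>R u'"]) simp_all
    fix w assume "w \<in> ?V"
    then obtain w' where "w' \<in> carr A" "w = x \<odot> x \<odot> w'" by blast
    then show "u + w \<in> ?V"
      using u x by (intro image_eqI[of _ _ "u' + w'"]) (simp_all add: mul_add_right)
  qed
  have shifted: "divided_power x (k + 2) \<in> ?V" for k
    by (rule image_eqI[of _ _ "(1 / fact (k + 2)) *\<^sub>R pw x k"])
      (use x in \<open>simp_all add: divided_power_def mul_assoc\<close>)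
  have "(\<Sum>k. divided_power x k) = (\<Sum>k. divided_power x (k + 2)) + (\<Sum>k<2. divided_power x k)"
    by (rule suminf_split_initial_segment[OF summable_divided_power[OF x]])
  moreover have "(\<Sum>k. divided_power x (k + 2)) \<in> ?V"
  proof -
    have "(\<lambda>n. \<Sum>k<n. divided_power x (k + 2)) \<longlonglongrightarrow> (\<Sum>k. divided_power x (k + 2))"
      by (rule summable_LIMSEQ) (use summable_divided_power[OF x] in \<open>simp only: summable_iff_shift\<close>)
    moreover have "(\<Sum>k<n. divided_power x (k + 2)) \<in> ?V" for n
      by (intro subspace_sum \<open>subspace ?V\<close> shifted)
    ultimately show ?thesis
      by (rule closed_sequentially[OF closed_subspace[OF \<open>subspace ?V\<close>], rotated])
  qed
  ultimately have "alg_exp A x - (\<one> + x) \<in> ?V"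
    using x by (simp add: alg_exp_divided_power divided_power_def numeral_2_eq_2)
  then obtain v where "v \<in> carr A" "alg_exp A x - (\<one> + x) = x \<odot> x \<odot> v"
    by blast
  then show thesis
    by (intro that[of v]) (simp_all add: algebra_simps)
qed

text \<open>
  If \<open>exp n = 1\<close>, the expansion says that \<open>n\<close> is absorbed by the nilpotent element \<open>- n * v\<close>.
\<close>

lemma exp_nil_eq_unit:
  assumes n: "nil n" and eq: "alg_exp A n = \<one>"
  shows "n = 0"
proof -
  note nc [simp] = nil_closed[OF n]
  obtain v where v: "v \<in> carr A" "alg_exp A n = \<one> + n + n \<odot> n \<odot> v"
    by (rule exp_expansion[OF nc])
  then have "n \<odot> (- (n \<odot> v)) = n"
    using eq by (simp add: mul_assoc add_eq_0_iff)
  moreover have "nil (- (n \<odot> v))"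
    using n v by (intro nil_minus nil_mul)
  ultimately show ?thesis
    using eq_mul_nil_imp_0 nc by blast
qed

text \<open>
  Modulo nilpotents the exponential only depends on the argument modulo nilpotents.
\<close>

lemma exp_add_nil_eq_unit:
  assumes s [simp]: "s \<in> carr A" and n: "nil n" and eq: "alg_exp A (s + n) = \<one>"
  shows "nil (alg_exp A s - \<one>)"
proof -
  note nc [simp] = nil_closed[OF n]
  obtain v where v [simp]: "v \<in> carr A" and e: "alg_exp A n = \<one> + n + n \<odot> n \<odot> v"
    by (rule exp_expansion[OF nc])
  have "\<one> = alg_exp A s \<odot> (\<one> + n + n \<odot> n \<odot> v)"
    using eq e by (simp add: exp_add)
  also have "\<dots> = alg_exp A s + n \<odot> (alg_exp A s \<odot> (\<one> + n \<odot> v))"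
    by (simp add: mul_distribs mul_ac)
  finally have "alg_exp A s - \<one> = - (n \<odot> (alg_exp A s \<odot> (\<one> + n \<odot> v)))"
    by (metis add_diff_cancel_left' minus_diff_eq)
  then show ?thesis
    using n by (simp add: nil_minus nil_mul)
qed

end

section \<open>Algebras whose elements are scalars up to nilpotents\<close>

text \<open>
  These are basis-free descriptions of the real and the complex unital nil algebras: the quotient by
  the nilpotent elements is \<open>\<real>\<close>, respectively \<open>\<complex>\<close> with a chosen lift \<open>\<iota>\<close> of the scalars.
\<close>

definition residue_real :: "('a::euclidean_space) alg \<Rightarrow> bool" where
  "residue_real A \<longleftrightarrow> uni A \<noteq> 0 \<and> (\<forall>x\<in>carr A. \<exists>r. nilpotent_in A (x - r *\<^sub>R uni A))"

definition residue_complex :: "('a::euclidean_space) alg \<Rightarrow> (complex \<Rightarrow> 'a) \<Rightarrow> bool" where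
  "residue_complex A \<iota> \<longleftrightarrow> uni A \<noteq> 0 \<and> alg_hom complex_alg A \<iota> \<and>
     (\<forall>x\<in>carr A. \<exists>c. nilpotent_in A (x - \<iota> c))"

lemma complex_homD:
  fixes c d :: complex and r :: real
  assumes "is_algebra A" "alg_hom complex_alg A \<iota>"
  shows "\<iota> c \<in> carr A" "\<iota> (c + d) = \<iota> c + \<iota> d" "\<iota> (c * d) = mul A (\<iota> c) (\<iota> d)"
    "\<iota> (r *\<^sub>R c) = r *\<^sub>R \<iota> c" "\<iota> 1 = uni A" "\<iota> 0 = 0" "\<iota> (- c) = - \<iota> c" "\<iota> (c - d) = \<iota> c - \<iota> d"
    "\<iota> (complex_of_real r) = r *\<^sub>R uni A" "alg_exp A (\<iota> c) = \<iota> (exp c)"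
proof -
  note D = alg_homD[OF assms(2), unfolded complex_alg_def, simplified]
  note B = is_algebra_complex assms
  have C: "x \<in> carr complex_alg" for x by (simp add: complex_alg_def)
  show "\<iota> c \<in> carr A" "\<iota> (c + d) = \<iota> c + \<iota> d" "\<iota> (c * d) = mul A (\<iota> c) (\<iota> d)"
    "\<iota> (r *\<^sub>R c) = r *\<^sub>R \<iota> c" "\<iota> 1 = uni A" "\<iota> 0 = 0" "\<iota> (- c) = - \<iota> c" "\<iota> (c - d) = \<iota> c - \<iota> d"
    "alg_exp A (\<iota> c) = \<iota> (exp c)"
    using D(1,2,3)[of c] D(4)[of r c] D(5) hom_0[OF B] hom_minus[OF B C] hom_diff[OF B C C] hom_exp[OF B C]
    by (simp_all add: alg_exp_complex)
  then show "\<iota> (complex_of_real r) = r *\<^sub>R uni A"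
    using D(4)[of r 1] by (simp add: scaleR_conv_of_real)
qed

context fd_algebra
begin

lemma real_nil_algebra_iff: "real_nil_algebra A \<longleftrightarrow> residue_real A"
proof
  assume "real_nil_algebra A"
  then obtain E where E: "\<one> \<notin> E" "\<And>e. e \<in> E \<Longrightarrow> nil e" "independent (insert \<one> E)"
    "span (insert \<one> E) = carr A"
    by (auto simp: real_nil_algebra_def)
  have "span E \<subseteq> {x. nil x}"
    by (rule span_minimal[OF _ subspace_nil]) (use E(2) in auto)
  moreover have "\<one> \<noteq> 0"
    using E(3) dependent_zero[of "insert \<one> E"] by auto
  moreover have "\<exists>r. x - r *\<^sub>R \<one> \<in> span E" if "x \<in> carr A" for x
    using that E(4) span_breakdown_eq[of x \<one> E] by simp
  ultimately show "residue_real A"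
    unfolding residue_real_def by blast
next
  assume R: "residue_real A"
  obtain E where E: "E \<subseteq> {x. nil x}" "independent E" "{x. nil x} \<subseteq> span E"
    using basis_exists[of "{x. nil x}"] by metis
  have span: "span E = {x. nil x}"
    using E span_minimal[OF _ subspace_nil] by blast
  have "\<one> \<notin> span E"
    using R nil_unit by (auto simp: span residue_real_def)
  then have "independent (insert \<one> E)" "\<one> \<notin> E"
    using E(2) span_base by (auto simp: independent_insert)
  moreover have "span (insert \<one> E) = carr A"
  proof
    show "span (insert \<one> E) \<subseteq> carr A"
      by (rule span_minimal[OF _ subspace_carr]) (use E(1) nil_closed in auto)
    show "carr A \<subseteq> span (insert \<one> E)"
      using R by (auto simp: span_breakdown_eq span residue_real_def)
  qed
  ultimately show "real_nil_algebra A"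
    unfolding real_nil_algebra_def using E(1) is_algebra by blast
qed

context
  fixes \<iota> assumes \<iota>: "alg_hom complex_alg A \<iota>"
begin

lemmas iota [simp] = complex_homD(1)[OF is_algebra \<iota>] and iota_simps = complex_homD(2-)[OF is_algebra \<iota>]

lemma nil_iota:
  assumes "nil (\<iota> c)" "\<one> \<noteq> 0"
  shows "c = 0"
proof (rule ccontr)
  assume "c \<noteq> 0"
  then have "\<iota> c \<odot> \<iota> (1 / c) = \<one>"
    by (simp flip: iota_simps(2,4))
  then show False
    using nil_mul[OF assms(1), of "\<iota> (1 / c)"] nil_unit assms(2) by simp
qed

lemma complex_basis_imp_residue_complex:
  assumes E: "finite E" "\<one> \<notin> E" "\<And>e. e \<in> E \<Longrightarrow> nil e"
    and rep: "\<And>x. x \<in> carr A \<Longrightarrow>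
      \<exists>!c. c \<in> insert \<one> E \<rightarrow>\<^sub>E UNIV \<and> x = (\<Sum>b\<in>insert \<one> E. \<iota> (c b) \<odot> b)"
  shows "residue_complex A \<iota>"
  unfolding residue_complex_def
proof (intro conjI ballI \<iota>)
  note Ec [simp] = nil_closed[OF E(3)]
  show "\<one> \<noteq> 0"
  proof
    assume "\<one> = 0"
    then have "0 = (\<Sum>b\<in>insert \<one> E. \<iota> (c b) \<odot> b)" for c
      using unit_zero_trivial Ec by (intro sum.neutral[symmetric]) auto
    then have "(\<lambda>b\<in>insert \<one> E. 0::complex) = (\<lambda>b\<in>insert \<one> E. 1)"
      using rep[of 0] by (metis (no_types, lifting) UNIV_I carr_closed(1) restrict_PiE_iff)
    then show False
      by (metis insertI1 restrict_apply' zero_neq_one)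
  qed
  fix x assume "x \<in> carr A"
  then obtain c where "x = (\<Sum>b\<in>insert \<one> E. \<iota> (c b) \<odot> b)"
    using rep by blast
  then have "x - \<iota> (c \<one>) = (\<Sum>b\<in>E. \<iota> (c b) \<odot> b)"
    using E by simp
  moreover have "nil (\<Sum>b\<in>E. \<iota> (c b) \<odot> b)"
    by (intro nil_sum nil_mul' E(3) iota)
  ultimately have "nil (x - \<iota> (c \<one>))"
    by simp
  then show "\<exists>c. nil (x - \<iota> c)" ..
qed

text \<open>
  Conversely a complex basis of the nilpotent elements is found as a generating set of least
  cardinality.
\<close>

lemma residue_complex_imp_complex_nil_algebra:
  assumes R: "residue_complex A \<iota>"
  shows "complex_nil_algebra A"
proof -
  have unit_nz: "\<one> \<noteq> 0"
    using R by (simp add: residue_complex_def)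
  define gen where "gen E \<longleftrightarrow> finite E \<and> E \<subseteq> {x. nil x} \<and>
    (\<forall>x. nil x \<longrightarrow> (\<exists>c. x = (\<Sum>b\<in>E. \<iota> (c b) \<odot> b)))" for E
  obtain E0 where E0: "E0 \<subseteq> {x. nil x}" "independent E0" "{x. nil x} \<subseteq> span E0"
    using basis_exists[of "{x. nil x}"] by metis
  have fin0: "finite E0"
    using E0(2) by (rule independent_imp_finite)
  have "gen E0"
    unfolding gen_def
  proof (intro conjI fin0 E0(1) allI impI)
    fix x assume "nil x"
    then obtain u where "x = (\<Sum>b\<in>E0. u b *\<^sub>R b)"
      using E0(3) span_finite[OF fin0] by auto
    also have "\<dots> = (\<Sum>b\<in>E0. \<iota> (complex_of_real (u b)) \<odot> b)"
      by (intro sum.cong refl) (use E0(1) in \<open>auto simp: iota_simps nil_closed\<close>)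
    finally show "\<exists>c. x = (\<Sum>b\<in>E0. \<iota> (c b) \<odot> b)"
      by (intro exI)
  qed
  then obtain E where E: "gen E" and least: "\<And>E'. gen E' \<Longrightarrow> card E \<le> card E'"
    using ex_has_least_nat[of gen E0 card] by blast
  have fin: "finite E" and nilE: "\<And>e. e \<in> E \<Longrightarrow> nil e"
    and genE: "\<And>x. nil x \<Longrightarrow> \<exists>c. x = (\<Sum>b\<in>E. \<iota> (c b) \<odot> b)"
    using E by (auto simp: gen_def)
  note Ec [simp] = nil_closed[OF nilE]
  have notin: "\<one> \<notin> E"
    using nilE nil_unit unit_nz by blast
  have indep: "f b0 = 0" if z: "(\<Sum>b\<in>E. \<iota> (f b) \<odot> b) = 0" and b0: "b0 \<in> E" for f b0
  proof (rule ccontr)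
    assume nz: "f b0 \<noteq> 0"
    have "gen (E - {b0})"
      unfolding gen_def
    proof (intro conjI allI impI)
      fix x assume "nil x"
      then obtain c where c: "x = (\<Sum>b\<in>E. \<iota> (c b) \<odot> b)"
        using genE by blast
      \<comment> \<open>Subtracting a multiple of the relation removes the coefficient at \<open>b0\<close>.\<close>
      define q where "q = c b0 / f b0"
      have "x = (\<Sum>b\<in>E. \<iota> (c b) \<odot> b) - \<iota> q \<odot> (\<Sum>b\<in>E. \<iota> (f b) \<odot> b)"
        by (simp add: z c)
      also have "\<dots> = (\<Sum>b\<in>E. \<iota> (c b - q * f b) \<odot> b)"
        by (simp add: mul_sum_right iota_simps mul_distribs mul_assoc flip: sum_subtractf)
      also have "\<dots> = (\<Sum>b\<in>E - {b0}. \<iota> (c b - q * f b) \<odot> b)"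
        using nz b0 by (simp add: sum.remove[OF fin b0] q_def iota_simps)
      finally show "\<exists>c. x = (\<Sum>b\<in>E - {b0}. \<iota> (c b) \<odot> b)"
        by (intro exI)
    qed (use fin nilE in auto)
    then show False
      using least[of "E - {b0}"] card_Diff1_less[OF fin b0] by simp
  qed
  have rep: "\<exists>!c. c \<in> insert \<one> E \<rightarrow>\<^sub>E UNIV \<and> x = (\<Sum>b\<in>insert \<one> E. \<iota> (c b) \<odot> b)"
    if xc: "x \<in> carr A" for x
  proof (rule ex_ex1I)
    obtain c0 where "nil (x - \<iota> c0)"
      using R xc by (auto simp: residue_complex_def)
    then obtain c where c: "x - \<iota> c0 = (\<Sum>b\<in>E. \<iota> (c b) \<odot> b)"
      using genE by blast
    define d where "d = (\<lambda>b\<in>insert \<one> E. if b = \<one> then c0 else c b)"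
    have "(\<Sum>b\<in>E. \<iota> (d b) \<odot> b) = (\<Sum>b\<in>E. \<iota> (c b) \<odot> b)"
      using notin by (intro sum.cong) (auto simp: d_def)
    moreover have "d \<one> = c0"
      by (simp add: d_def)
    ultimately have "x = (\<Sum>b\<in>insert \<one> E. \<iota> (d b) \<odot> b)"
      using fin notin c by (simp add: diff_eq_eq add.commute)
    moreover have "d \<in> insert \<one> E \<rightarrow>\<^sub>E UNIV"
      by (simp add: d_def)
    ultimately show "\<exists>c. c \<in> insert \<one> E \<rightarrow>\<^sub>E UNIV \<and> x = (\<Sum>b\<in>insert \<one> E. \<iota> (c b) \<odot> b)"
      by blast
  next
    fix c d
    assume c: "c \<in> insert \<one> E \<rightarrow>\<^sub>E UNIV \<and> x = (\<Sum>b\<in>insert \<one> E. \<iota> (c b) \<odot> b)"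
      and d: "d \<in> insert \<one> E \<rightarrow>\<^sub>E UNIV \<and> x = (\<Sum>b\<in>insert \<one> E. \<iota> (d b) \<odot> b)"
    have rel: "\<iota> (c \<one> - d \<one>) + (\<Sum>b\<in>E. \<iota> (c b - d b) \<odot> b) = 0"
      using c d fin notin
      by (simp add: iota_simps mul_distribs sum_subtractf) (simp add: algebra_simps)
    have "nil (\<Sum>b\<in>E. \<iota> (c b - d b) \<odot> b)"
      by (intro nil_sum nil_mul' nilE iota)
    then have "nil (\<iota> (c \<one> - d \<one>))"
      using rel nil_minus by (metis add_eq_0_iff2)
    then have eq1: "c \<one> - d \<one> = 0"
      using nil_iota unit_nz by blast
    with rel have "(\<Sum>b\<in>E. \<iota> (c b - d b) \<odot> b) = 0"
      by (simp add: iota_simps)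
    then have "c b - d b = 0" if "b \<in> E" for b
      by (rule indep[OF _ that])
    with eq1 show "c = d"
      using c d by (intro PiE_ext[of c "insert \<one> E" "\<lambda>_. UNIV" d]) auto
  qed
  show ?thesis
    unfolding complex_nil_algebra_def
  proof (rule conjI[OF is_algebra], rule exI[of _ \<iota>], rule exI[of _ E])
    have "\<forall>e\<in>E. nil e"
      using nilE by blast
    moreover have "\<forall>x\<in>carr A.
        \<exists>!c. c \<in> insert \<one> E \<rightarrow>\<^sub>E UNIV \<and> x = (\<Sum>b\<in>insert \<one> E. \<iota> (c b) \<odot> b)"
      by (rule ballI) (rule rep)
    ultimately show "alg_hom complex_alg A \<iota> \<and> finite E \<and> \<one> \<notin> E \<and> (\<forall>e\<in>E. nil e) \<and>
      (\<forall>x\<in>carr A.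
        \<exists>!c. c \<in> insert \<one> E \<rightarrow>\<^sub>E UNIV \<and> x = (\<Sum>b\<in>insert \<one> E. \<iota> (c b) \<odot> b))"
      by (intro conjI \<iota> fin notin)
  qed
qed

end

lemma complex_nil_algebra_iff: "complex_nil_algebra A \<longleftrightarrow> (\<exists>\<iota>. residue_complex A \<iota>)"
proof
  assume "complex_nil_algebra A"
  then obtain \<iota> E where \<iota>: "alg_hom complex_alg A \<iota>"
    and E: "finite E" "\<one> \<notin> E" "\<forall>e\<in>E. nil e"
    and rep: "\<forall>x\<in>carr A.
      \<exists>!c. c \<in> insert \<one> E \<rightarrow>\<^sub>E UNIV \<and> x = (\<Sum>b\<in>insert \<one> E. \<iota> (c b) \<odot> b)"
    unfolding complex_nil_algebra_def by (elim conjE exE)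
  have "residue_complex A \<iota>"
    by (rule complex_basis_imp_residue_complex[OF \<iota> E(1,2) bspec[OF E(3)] bspec[OF rep]])
  then show "\<exists>\<iota>. residue_complex A \<iota>" by blast
next
  assume "\<exists>\<iota>. residue_complex A \<iota>"
  then obtain \<iota> where R: "residue_complex A \<iota>" by blast
  then have "alg_hom complex_alg A \<iota>"
    by (simp add: residue_complex_def)
  then show "complex_nil_algebra A"
    using R by (rule residue_complex_imp_complex_nil_algebra)
qed

text \<open>
  If \<open>exp (r + n) = 1\<close> with \<open>n\<close> nilpotent, then reducing modulo nilpotents gives \<open>exp r = 1\<close> for the
  scalar \<open>r\<close>, and then \<open>exp n = 1\<close>, so that \<open>n = 0\<close>. Hence only the periods of the scalar exponential
  remain: only \<open>0\<close> over \<open>\<real>\<close>, and \<open>2 * pi * \<i> * k\<close> over \<open>\<complex>\<close>.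
\<close>

lemma residue_real_exp_eq_unit:
  assumes R: "residue_real A" and z: "z \<in> carr A" "alg_exp A z = \<one>"
  shows "z = 0"
proof -
  have unit_nz: "\<one> \<noteq> 0"
    using R by (simp add: residue_real_def)
  have "alg_hom real_alg A (\<lambda>r. r *\<^sub>R \<one>)"
    by (simp add: alg_hom_def real_alg_def algebra_simps)
  then have exp_scalar: "alg_exp A (r *\<^sub>R \<one>) = exp r *\<^sub>R \<one>" for r
    using hom_exp[OF is_algebra_real is_algebra, of "\<lambda>r. r *\<^sub>R \<one>" r]
    by (simp add: alg_exp_real) (simp add: real_alg_def)
  obtain r where n: "nil (z - r *\<^sub>R \<one>)"
    using R z(1) by (auto simp: residue_real_def)
  have "nil ((exp r - 1) *\<^sub>R \<one>)"
    using exp_add_nil_eq_unit[of "r *\<^sub>R \<one>", OF _ n] z(2) by (simp add: exp_scalar algebra_simps)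
  then have "exp r - 1 = 0"
    by (rule nil_scaled_unit[OF _ unit_nz])
  then have "r = 0"
    by simp
  then show ?thesis
    using exp_nil_eq_unit n z(2) by simp
qed

lemma residue_complex_exp_eq_unit:
  assumes R: "residue_complex A \<iota>" and z: "z \<in> carr A" "alg_exp A z = \<one>"
  obtains k :: int where "z = \<iota> (\<i> * of_real (2 * pi * of_int k))"
proof -
  have unit_nz: "\<one> \<noteq> 0" and \<iota>: "alg_hom complex_alg A \<iota>"
    using R by (simp_all add: residue_complex_def)
  note [simp] = complex_homD(1)[OF is_algebra \<iota>] and iota_simps = complex_homD(2-)[OF is_algebra \<iota>]
  obtain c where n: "nil (z - \<iota> c)"
    using R z(1) by (auto simp: residue_complex_def)
  have "nil (\<iota> (exp c - 1))"
    using exp_add_nil_eq_unit[of "\<iota> c", OF _ n] z(2) by (simp add: iota_simps)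
  then have c: "exp c = 1"
    using nil_iota[OF \<iota> _ unit_nz, of "exp c - 1"] by simp
  then obtain k :: int where "c = \<i> * of_real (2 * pi * of_int k)"
    using exp_eq_1[of c] by (auto simp: complex_eq_iff)
  moreover have "alg_exp A (z - \<iota> c) = \<one>"
    using exp_eq_iff[of z "\<iota> c"] z c by (simp add: iota_simps)
  then have "z = \<iota> c"
    using exp_nil_eq_unit[OF n] by simp
  ultimately show thesis
    using that by simp
qed

definition residue :: "(complex \<Rightarrow> 'a) \<Rightarrow> 'a \<Rightarrow> complex" where
  "residue \<iota> x = (THE c. nil (x - \<iota> c))"

lemma residue_eq:
  assumes R: "residue_complex A \<iota>" and n: "nil (x - \<iota> c)"
  shows "residue \<iota> x = c"
  unfolding residue_def
proof (rule the_equality[of "\<lambda>c. nil (x - \<iota> c)", OF n])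
  have unit_nz: "\<one> \<noteq> 0" and \<iota>: "alg_hom complex_alg A \<iota>"
    using R by (simp_all add: residue_complex_def)
  show "d = c" if "nil (x - \<iota> d)" for d
    using nil_diff[OF that n] nil_iota[OF \<iota> _ unit_nz, of "c - d"]
    by (simp add: complex_homD(8)[OF is_algebra \<iota>])
qed

lemma residue_simps:
  assumes R: "residue_complex A \<iota>"
  shows "residue \<iota> (\<iota> c) = c"
    and "x \<in> carr A \<Longrightarrow> y \<in> carr A \<Longrightarrow> residue \<iota> (x + y) = residue \<iota> x + residue \<iota> y"
    and "x \<in> carr A \<Longrightarrow> residue \<iota> (r *\<^sub>R x) = r *\<^sub>R residue \<iota> x"
proof -
  have \<iota>: "alg_hom complex_alg A \<iota>"
    using R by (simp add: residue_complex_def)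
  have n: "nil (x - \<iota> (residue \<iota> x))" if "x \<in> carr A" for x
    using R that residue_eq[OF R] by (auto simp: residue_complex_def)
  show "residue \<iota> (\<iota> c) = c"
    by (rule residue_eq[OF R]) simp
  show "residue \<iota> (x + y) = residue \<iota> x + residue \<iota> y" if "x \<in> carr A" "y \<in> carr A"
    using nil_add[OF n n, OF that]
    by (intro residue_eq[OF R]) (simp add: complex_homD[OF is_algebra \<iota>] algebra_simps)
  show "residue \<iota> (r *\<^sub>R x) = r *\<^sub>R residue \<iota> x" if "x \<in> carr A"
    using nil_scale[OF n[OF that], of r]
    by (intro residue_eq[OF R]) (simp only: complex_homD[OF is_algebra \<iota>] scaleR_diff_right)
qed

end

section \<open>Type-C algebras have nonzero periods\<close>

text \<open>
  The scalar multiples of the unit of a complexification are a copy of \<open>\<complex>\<close>, just as the scalars of a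
  complex nil algebra, so the period \<open>2 * pi * \<i>\<close> of \<open>\<complex>\<close> is one of any type-C algebra.
\<close>

lemma type_C_complex_hom:
  assumes "type_C A"
  obtains \<iota> where "is_algebra A" "uni A \<noteq> 0" "alg_hom complex_alg A \<iota>"
proof -
  have A: "is_algebra A" and nz: "carr A \<noteq> {0}"
    using assms by (simp_all add: type_C_def)
  interpret fd_algebra A by unfold_locales (rule A)
  consider B :: "'a alg" where "is_algebra B" "alg_iso A (complexification B)" | "complex_nil_algebra A"
    using assms by (auto simp: type_C_def)
  then show thesis
  proof cases
    case (1 B)
    interpret B: fd_algebra B by unfold_locales (rule 1(1))
    obtain f where f: "alg_hom A (complexification B) f" "bij_betw f (carr A) (carr (complexification B))"
      using 1(2) by (auto simp: alg_iso_def)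
    have "alg_hom complex_alg (complexification B) (\<lambda>c. (Re c *\<^sub>R uni B, Im c *\<^sub>R uni B))"
      by (simp add: alg_hom_def complex_alg_def complexification_def algebra_simps)
    then show thesis
      using that[OF A] alg_hom_comp[OF _ alg_hom_inverse[OF A f]] nz nontrivial by blast
  next
    case 2
    then show thesis
      using that[OF A] nz nontrivial by (auto simp: complex_nil_algebra_def)
  qed
qed

lemma type_C_period:
  assumes "type_C A"
  obtains p where "p \<in> carr A" "p \<noteq> 0" "alg_exp A p = uni A"
proof -
  obtain \<iota> where A: "is_algebra A" and nz: "uni A \<noteq> 0" and \<iota>: "alg_hom complex_alg A \<iota>"
    using type_C_complex_hom[OF assms] by blast
  interpret fd_algebra A by unfold_locales (rule A)
  note D = complex_homD[OF A \<iota>]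
  let ?c = "2 * of_real pi * \<i> :: complex"
  show thesis
  proof (rule that[of "\<iota> ?c"])
    show "\<iota> ?c \<noteq> 0"
      using nil_iota[OF \<iota> _ nz, of ?c] by force
    have "exp ?c = 1"
      by (rule exp_two_pi_i)
    then show "alg_exp A (\<iota> ?c) = \<one>"
      by (simp only: D(5,10))
  qed (rule D(1))
qed

section \<open>Corners\<close>

text \<open>
  The corner at an idempotent \<open>e\<close> is the ideal generated by \<open>e\<close>, an algebra with unit \<open>e\<close>. Direct
  factors of an algebra are its corners up to isomorphism.
\<close>

definition corner :: "'a alg \<Rightarrow> 'a \<Rightarrow> 'a alg" where
  "corner A e = \<lparr>carr = {x \<in> carr A. mul A e x = x}, mul = mul A, uni = e\<rparr>"

lemma corner_sel [simp]:
  "carr (corner A e) = {x \<in> carr A. mul A e x = x}" "mul (corner A e) = mul A" "uni (corner A e) = e"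
  by (simp_all add: corner_def)

context fd_algebra
begin

definition idem :: "'a \<Rightarrow> bool" where "idem e \<longleftrightarrow> e \<in> carr A \<and> e \<odot> e = e"

lemma idem_absorb [simp]: "idem e \<Longrightarrow> x \<in> carr A \<Longrightarrow> e \<odot> (e \<odot> x) = e \<odot> x"
  by (metis idem_def mul_assoc)

lemma idem_complement: "idem e \<Longrightarrow> idem (\<one> - e)"
  by (simp add: idem_def mul_distribs)

lemma is_algebra_corner: "idem e \<Longrightarrow> is_algebra (corner A e)"
  by (auto simp: is_algebra_def idem_def mul_distribs mul_ac intro!: subspaceI)

lemma corner_hom: "idem e \<Longrightarrow> alg_hom A (corner A e) ((\<odot>) e)"
  by (auto simp: alg_hom_def idem_def mul_distribs) (metis idem_absorb idem_def carr_closed(3) mul_lcomm mul_assoc)+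

lemma exp_corner: "idem e \<Longrightarrow> x \<in> carr A \<Longrightarrow> alg_exp (corner A e) (e \<odot> x) = e \<odot> alg_exp A x"
  using hom_exp[OF is_algebra is_algebra_corner corner_hom] by simp

end

section \<open>Algebras without nontrivial idempotents\<close>

context fd_algebra
begin

definition peval :: "'a \<Rightarrow> real poly \<Rightarrow> 'a" where
  "peval x p = (\<Sum>i\<le>degree p. coeff p i *\<^sub>R pw x i)"

lemma peval_closed [simp]: "x \<in> carr A \<Longrightarrow> peval x p \<in> carr A"
  by (simp add: peval_def)

lemma peval_bound: "degree p \<le> n \<Longrightarrow> peval x p = (\<Sum>i\<le>n. coeff p i *\<^sub>R pw x i)"
  unfolding peval_def by (rule sum.mono_neutral_left) (auto simp: coeff_eq_0)

lemma peval_0 [simp]: "peval x 0 = 0"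
  by (simp add: peval_def)

lemma peval_add: "peval x (p + q) = peval x p + peval x q"
  using degree_add_le[of p "max (degree p) (degree q)" q]
  by (simp add: peval_bound[of _ "max (degree p) (degree q)"] sum.distrib scaleR_add_left)

lemma peval_smult: "peval x (smult c p) = c *\<^sub>R peval x p"
  by (simp add: peval_bound[of _ "degree p"] degree_smult_le scaleR_sum_right)

lemma peval_pCons: "x \<in> carr A \<Longrightarrow> peval x (pCons a p) = a *\<^sub>R \<one> + x \<odot> peval x p"
proof -
  assume x: "x \<in> carr A"
  have "peval x (pCons a p) = (\<Sum>i\<le>Suc (degree p). coeff (pCons a p) i *\<^sub>R pw x i)"
    by (rule peval_bound) (simp add: degree_pCons_le)
  also have "\<dots> = a *\<^sub>R \<one> + (\<Sum>i\<le>degree p. coeff p i *\<^sub>R pw x (Suc i))"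
    by (subst sum.atMost_Suc_shift) simp
  finally show ?thesis
    using x by (simp add: peval_def mul_sum_right)
qed

lemma peval_mult: "x \<in> carr A \<Longrightarrow> peval x (p * q) = peval x p \<odot> peval x q"
proof (induction p)
  case (pCons a p)
  then show ?case
    by (simp add: peval_add peval_smult peval_pCons mul_distribs mul_assoc)
qed simp

lemma annihilating_poly:
  obtains p :: "real poly" where "p \<noteq> 0" "peval x p = 0"
proof -
  let ?I = "{..DIM('a)}"
  show thesis
  proof (cases "inj_on (pw x) ?I")
    case True
    then have "dependent (pw x ` ?I)"
      using independent_card_le[of "pw x ` ?I"] by (auto simp: card_image)
    then obtain u i where u: "(\<Sum>v\<in>pw x ` ?I. u v *\<^sub>R v) = 0" "i \<in> ?I" "u (pw x i) \<noteq> 0"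
      by (auto simp: dependent_finite)
    let ?p = "\<Sum>i\<in>?I. monom (u (pw x i)) i"
    have coeff: "coeff ?p j = (if j \<le> DIM('a) then u (pw x j) else 0)" for j
      by (simp add: coeff_sum)
    have "degree ?p \<le> DIM('a)"
      by (rule degree_le) (simp add: coeff)
    then have "peval x ?p = (\<Sum>j\<in>?I. u (pw x j) *\<^sub>R pw x j)"
      by (subst peval_bound) (auto simp: coeff)
    also have "\<dots> = 0"
      using u(1) True by (simp add: sum.reindex)
    finally show thesis
      using u coeff[of i] by (intro that[of ?p]) auto
  next
    case False
    then obtain i j where ij: "i \<noteq> j" "pw x i = pw x j"
      by (auto simp: inj_on_def)
    have "peval x (monom c k) = c *\<^sub>R pw x k" for c k
      by (simp add: peval_bound[of _ k] degree_monom_le coeff_monom if_distrib[of "\<lambda>c. c *\<^sub>R _"] cong: if_cong)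
    then have "peval x (monom 1 i + monom (-1) j) = 0"
      using ij by (simp add: peval_add)
    moreover have "monom 1 i + monom (-1 :: real) j \<noteq> 0"
    proof
      assume "monom 1 i + monom (-1 :: real) j = 0"
      then have "coeff (monom 1 i + monom (-1 :: real) j) i = 0"
        by simp
      then show False
        using ij by simp
    qed
    ultimately show thesis
      by (intro that)
  qed
qed

text \<open>
  Write an annihilating polynomial of \<open>x\<close> as \<open>X ^ k * q\<close> with \<open>q 0 \<noteq> 0\<close>. Then \<open>x ^ k\<close> is absorbed
  by a multiple \<open>y\<close> of \<open>x\<close>, and \<open>y ^ k\<close> is an idempotent. If it is \<open>0\<close>, so is \<open>x ^ k = x ^ k * y ^ k\<close>;
  if it is the unit, the factor \<open>x\<close> of \<open>y\<close> is invertible.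
\<close>

lemma idempotent_dichotomy:
  assumes x: "x \<in> carr A"
  obtains e where "idem e" "e = 0 \<longrightarrow> nil x" "e = \<one> \<longrightarrow> (\<exists>y\<in>carr A. x \<odot> y = \<one>)"
proof -
  obtain p where p: "p \<noteq> 0" "peval x p = 0"
    by (rule annihilating_poly)
  obtain q where q: "p = [:0, 1:] ^ order 0 p * q" "\<not> [:0, 1:] dvd q"
    using order_decomp[OF p(1), of 0] by auto
  obtain c r where cr: "q = pCons c r" by (rule pCons_cases)
  have c: "c \<noteq> 0"
    using q(2) cr by (auto simp: dvd_iff_poly_eq_0 simp flip: poly_eq_0_iff_dvd)
  \<comment> \<open>The successor ensures that \<open>x\<close> divides \<open>y ^ k\<close>, even if \<open>0\<close> is not a root of \<open>p\<close>.\<close>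
  define k where "k = Suc (order 0 p)"
  have "peval x ([:0, 1:] ^ n) = pw x n" for n
    by (induction n) (simp_all add: x peval_mult peval_pCons one_pCons)
  then have "pw x (order 0 p) \<odot> peval x q = 0"
    using p(2) q(1) x by (metis peval_mult)
  then have van: "pw x k \<odot> (c *\<^sub>R \<one> + x \<odot> peval x r) = 0"
    using x by (simp add: k_def cr peval_pCons mul_assoc)
  define w where "w = (- 1 / c) *\<^sub>R peval x r"
  have w [simp]: "w \<in> carr A" by (simp add: w_def x)
  define y where "y = x \<odot> w"
  have y [simp]: "y \<in> carr A" by (simp add: y_def x)
  have "pw x k \<odot> (c *\<^sub>R \<one> + x \<odot> peval x r) = c *\<^sub>R (pw x k - pw x k \<odot> y)"
    using x c by (simp add: y_def w_def mul_distribs scaleR_add_right)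
  with van c have step: "pw x k \<odot> y = pw x k" by simp
  have absorb: "pw x k \<odot> pw y l = pw x k" for l
  proof (induction l)
    case (Suc l)
    have "pw x k \<odot> pw y (Suc l) = (pw x k \<odot> y) \<odot> pw y l"
      using x by (simp add: mul_assoc)
    then show ?case using Suc step by simp
  qed (simp add: x)
  have yk: "pw y k = pw w k \<odot> pw x k"
    using x by (simp add: y_def pw_mul mul_comm)
  show thesis
  proof (rule that[of "pw y k"])
    have "pw y k \<odot> pw y k = pw w k \<odot> (pw x k \<odot> pw y k)"
      using x by (simp add: yk mul_assoc)
    then show "idem (pw y k)"
      using pw_closed[OF y, of k] by (simp only: idem_def absorb yk[symmetric] simp_thms)
    show "pw y k = 0 \<longrightarrow> nil x"
      using absorb[of k] x by (auto intro: nilI[of _ k])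
    have "x \<odot> (w \<odot> pw y (order 0 p)) = pw y k"
      using x by (simp add: k_def y_def mul_assoc)
    then show "pw y k = \<one> \<longrightarrow> (\<exists>y\<in>carr A. x \<odot> y = \<one>)"
      by (intro impI bexI[of _ "w \<odot> pw y (order 0 p)"]) (simp_all add: x)
  qed
qed

text \<open>
  One Newton step for the equation \<open>y\<^sup>2 + 1 = 0\<close>: it replaces the error \<open>n\<close> by a multiple of
  \<open>n\<^sup>2\<close>.
\<close>

lemma newton_step:
  assumes y: "y \<in> carr A"
  obtains y' v where "y' \<in> carr A" "v \<in> carr A"
    "y' \<odot> y' + \<one> = (y \<odot> y + \<one>) \<odot> (y \<odot> y + \<one>) \<odot> v"
proof -
  \<comment> \<open>The step is \<open>y' = y + y * n / 2\<close>, where \<open>- y\<close> replaces the inverse of \<open>y\<close> in Newton's formula.\<close>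
  have one: "peval y 1 = \<one>" and n: "peval y [:1, 0, 1:] = y \<odot> y + \<one>"
    using y by (simp_all add: one_pCons peval_pCons add.commute)
  have "([:0, 3/2, 0, 1/2:] * [:0, 3/2, 0, 1/2:] + 1 :: real poly) =
      [:1, 0, 1:] * [:1, 0, 1:] * [:1, 0, 1/4:]"
    by (simp add: one_pCons)
  then have "peval y ([:0, 3/2, 0, 1/2:] * [:0, 3/2, 0, 1/2:] + 1) =
      peval y ([:1, 0, 1:] * [:1, 0, 1:] * [:1, 0, 1/4:])"
    by (rule arg_cong)
  then have "peval y [:0, 3/2, 0, 1/2:] \<odot> peval y [:0, 3/2, 0, 1/2:] + \<one> =
      (y \<odot> y + \<one>) \<odot> (y \<odot> y + \<one>) \<odot> peval y [:1, 0, 1/4:]"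
    by (simp only: peval_add peval_mult[OF y] one n)
  then show thesis
    using y by (intro that) simp_all
qed

lemma lift_sqrt_minus_one:
  assumes "y \<in> carr A" "pw (y \<odot> y + \<one>) (Suc k) = 0"
  shows "\<exists>j\<in>carr A. j \<odot> j = - \<one>"
  using assms
proof (induction k arbitrary: y)
  case 0
  then show ?case
    by (auto simp: add_eq_0_iff2 intro!: bexI[of _ y])
next
  case (Suc k)
  let ?n = "y \<odot> y + \<one>"
  obtain y' v where y': "y' \<in> carr A" "v \<in> carr A" "y' \<odot> y' + \<one> = ?n \<odot> ?n \<odot> v"
    by (rule newton_step[OF Suc.prems(1)])
  have "pw (y' \<odot> y' + \<one>) (Suc k) = pw ?n (Suc k + Suc k) \<odot> pw v (Suc k)"
    using y' Suc.prems(1) by (simp only: pw_add pw_mul carr_closed)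
  also have "pw ?n (Suc k + Suc k) = 0"
    by (rule pw_eq_0_mono[OF _ Suc.prems(2)]) (use Suc.prems(1) in simp_all)
  finally show ?case
    using Suc.IH[of y'] y' by simp
qed

text \<open>
  The following conditions on the unit and the idempotents make the algebra local: its elements are nilpotent
  or invertible.
\<close>

context
  assumes nontriv: "\<one> \<noteq> 0" and connected: "\<And>e. idem e \<Longrightarrow> e = 0 \<or> e = \<one>"
begin

lemma nil_or_unit:
  assumes "x \<in> carr A"
  shows "nil x \<or> (\<exists>y\<in>carr A. x \<odot> y = \<one>)"
proof -
  obtain e where "idem e" "e = 0 \<longrightarrow> nil x" "e = \<one> \<longrightarrow> (\<exists>y\<in>carr A. x \<odot> y = \<one>)"
    by (rule idempotent_dichotomy[OF assms])
  then show ?thesis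
    using connected[of e] by blast
qed

lemma nil_mul_prime:
  assumes x: "x \<in> carr A" and y: "y \<in> carr A" and n: "nil (x \<odot> y)"
  shows "nil x \<or> nil y"
proof -
  have "nil y" if z: "z \<in> carr A" "x \<odot> z = \<one>" for z
  proof -
    have "z \<odot> (x \<odot> y) = (x \<odot> z) \<odot> y"
      using x y z(1) by (simp add: mul_ac)
    then show ?thesis
      using nil_mul'[OF n z(1)] z(2) y by simp
  qed
  then show ?thesis
    using nil_or_unit[OF x] by blast
qed

text \<open>
  The quadratic polynomial has the roots \<open>a + b * \<i>\<close> and \<open>a - b * \<i>\<close>, where \<open>a + b * \<i>\<close> is a complex
  root of \<open>p\<close>, which is not constant because nonzero constants are invertible. A factor of \<open>p\<close> with this root is split off; either its value is nilpotent or the value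
  of the cofactor is, by \<open>nil_mul_prime\<close>.
\<close>

lemma nil_poly_imp_nil_quadratic:
  assumes x: "x \<in> carr A" and "p \<noteq> 0" "nil (peval x p)"
  shows "\<exists>a b. nil (peval x [:a\<^sup>2 + b\<^sup>2, - 2 * a, 1:])"
  using assms(2-)
proof (induction "degree p" arbitrary: p rule: less_induct)
  case less
  interpret C: fd_algebra complex_alg by unfold_locales (rule is_algebra_complex)
  have C: "z \<in> carr complex_alg" for z by (simp add: complex_alg_def)
  have C_eval: "C.peval z p = poly (map_poly of_real p) z" for z p
    by (simp add: C.peval_def poly_altdef alg_power_complex degree_map_poly coeff_map_poly scaleR_conv_of_real)
  show ?case
  proof (cases "degree p = 0")
    case True
    then obtain c where c: "p = [:c:]" by (rule degree_eq_zeroE)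
    then have "nil (c *\<^sub>R \<one>)"
      using less.prems x by (simp add: peval_pCons)
    then have "c = 0"
      using nontriv by (rule nil_scaled_unit)
    then show ?thesis
      using less.prems(1) c by simp
  next
    case False
    have "degree (map_poly complex_of_real p) = degree p"
      by (simp add: degree_map_poly)
    then have "\<not> (\<exists>a l. a \<noteq> 0 \<and> l = 0 \<and> map_poly complex_of_real p = pCons a l)"
      using False by auto
    then obtain z where z: "poly (map_poly complex_of_real p) z = 0"
      using fundamental_theorem_of_algebra_alt by blast
    define a b where "a = Re z" and "b = Im z"
    let ?d = "[:a\<^sup>2 + b\<^sup>2, - 2 * a, 1:]"
    have finish: ?thesis if pd: "p = d * r" and d: "degree d > 0" "nil (peval x d) \<Longrightarrow> nil (peval x ?d)" for d r
    proof -
      have "r \<noteq> 0" "degree r < degree p"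
        using pd d(1) less.prems(1) by (auto simp: degree_mult_eq)
      then show ?thesis
        using nil_mul_prime[of "peval x d" "peval x r"] less.prems(2) less.hyps[of r] d(2) pd x
        by (auto simp: peval_mult)
    qed
    show ?thesis
    proof (cases "b = 0")
      case True
      then have "z = of_real a"
        by (simp add: a_def b_def complex_eq_iff)
      then have "complex_of_real (poly p a) = 0"
        using z by (simp add: poly_altdef degree_map_poly coeff_map_poly)
      then obtain r where "p = [:- a, 1:] * r"
        by (auto simp: poly_eq_0_iff_dvd)
      moreover have "?d = [:- a, 1:] * [:- a, 1:]"
        using True by (simp add: power2_eq_square)
      ultimately show ?thesis
        using finish[of "[:- a, 1:]" r] nil_mul x by (simp only: peval_mult) simp
    next
      case False
      have "degree (p mod ?d) < 2"
        using degree_mod_less'[of ?d p] by (cases "p mod ?d = 0") auto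
      then have "p mod ?d = [:coeff (p mod ?d) 0, coeff (p mod ?d) 1:]"
        by (intro poly_eqI) (auto simp: coeff_pCons split: nat.splits intro: coeff_eq_0)
      then obtain s t where st: "p mod ?d = [:s, t:]"
        by blast
      have d0: "C.peval z ?d = 0"
        by (simp add: C_eval map_poly_pCons a_def b_def complex_eq_iff power2_eq_square algebra_simps)
      have "C.peval z p = C.peval z (?d * (p div ?d) + p mod ?d)"
        by (simp only: mult_div_mod_eq)
      then have "C.peval z (p mod ?d) = 0"
        using z d0 C by (simp only: C.peval_add C.peval_mult[OF C] C_eval[of z p]) simp
      then have "C.peval z [:s, t:] = 0"
        by (simp only: st)
      then have "s + t * a = 0" "t * b = 0"
        by (simp_all add: C_eval map_poly_pCons complex_eq_iff a_def b_def mult.commute)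
      then have "p mod ?d = 0"
        using False st by simp
      then have "p = ?d * (p div ?d)"
        by (metis add.right_neutral mult_div_mod_eq)
      then show ?thesis
        by (rule finish) simp_all
    qed
  qed
qed

text \<open>
  By \<open>nil_poly_imp_nil_quadratic\<close> the residue field is \<open>\<real>\<close> or contains a square root of \<open>-1\<close>. In
  the latter case the root lifts, the algebra becomes one over \<open>\<complex>\<close>, and the quadratic
  polynomials split.
\<close>

lemma connected_imp_unital_nil_algebra: "unital_nil_algebra A"
proof (cases "\<forall>x\<in>carr A. \<exists>r. nil (x - r *\<^sub>R \<one>)")
  case True
  then show ?thesis
    using nontriv by (simp add: unital_nil_algebra_def real_nil_algebra_iff residue_real_def)
next
  case False
  have quad: "\<exists>a b. nil (x \<odot> x - (2 * a) *\<^sub>R x + (a\<^sup>2 + b\<^sup>2) *\<^sub>R \<one>)" if x: "x \<in> carr A" for x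
  proof -
    obtain p where p: "p \<noteq> 0" "peval x p = 0"
      by (rule annihilating_poly)
    obtain a b where "nil (peval x [:a\<^sup>2 + b\<^sup>2, - 2 * a, 1:])"
      using nil_poly_imp_nil_quadratic[OF x p(1)] p(2) by auto
    moreover have "peval x [:a\<^sup>2 + b\<^sup>2, - 2 * a, 1:] = x \<odot> x - (2 * a) *\<^sub>R x + (a\<^sup>2 + b\<^sup>2) *\<^sub>R \<one>"
      using x by (simp add: peval_pCons mul_distribs)
    ultimately show ?thesis by metis
  qed
  obtain x where x [simp]: "x \<in> carr A" and no_real: "\<And>r. \<not> nil (x - r *\<^sub>R \<one>)"
    using False by blast
  obtain a b where ab: "nil (x \<odot> x - (2 * a) *\<^sub>R x + (a\<^sup>2 + b\<^sup>2) *\<^sub>R \<one>)"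
    using quad[OF x] by blast
  let ?u = "x - a *\<^sub>R \<one>"
  have square: "x \<odot> x - (2 * a) *\<^sub>R x + (a\<^sup>2 + b\<^sup>2) *\<^sub>R \<one> = ?u \<odot> ?u + b\<^sup>2 *\<^sub>R \<one>"
  proof -
    have "(2 * a) *\<^sub>R x = a *\<^sub>R x + a *\<^sub>R x"
      by (simp flip: scaleR_add_left)
    then show ?thesis
      by (simp add: mul_distribs power2_eq_square scaleR_add_left scaleR_diff_right)
  qed
  have b: "b \<noteq> 0"
    using ab no_real[of a] nil_square[of ?u] unfolding square by auto
  let ?y = "(1 / b) *\<^sub>R ?u"
  have "?y \<odot> ?y + \<one> = (1 / b\<^sup>2) *\<^sub>R (?u \<odot> ?u + b\<^sup>2 *\<^sub>R \<one>)"
    using b by (simp add: scaleR_add_right power2_eq_square)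
  then have "nil (?y \<odot> ?y + \<one>)"
    using nil_scale[OF ab] by (simp only: square)
  then obtain k where "pw (?y \<odot> ?y + \<one>) k = 0"
    by (auto simp: nilpotent_in_def)
  then have "pw (?y \<odot> ?y + \<one>) (Suc k) = 0"
    by (rule pw_eq_0_mono[rotated]) simp_all
  then obtain j where j [simp]: "j \<in> carr A" and jj: "j \<odot> j = - \<one>"
    using lift_sqrt_minus_one[of ?y k] by auto
  define \<iota> where "\<iota> = (\<lambda>c. Re c *\<^sub>R \<one> + Im c *\<^sub>R j)"
  have \<iota>: "alg_hom complex_alg A \<iota>"
    by (simp add: alg_hom_def complex_alg_def \<iota>_def mul_distribs jj algebra_simps)
  note D = complex_homD[OF is_algebra \<iota>]
  have "\<exists>c. nil (x - \<iota> c)" if x [simp]: "x \<in> carr A" for x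
  proof -
    obtain a b where ab: "nil (x \<odot> x - (2 * a) *\<^sub>R x + (a\<^sup>2 + b\<^sup>2) *\<^sub>R \<one>)"
      using quad[OF x] by blast
    have "(x - \<iota> (Complex a b)) \<odot> (x - \<iota> (Complex a (- b))) =
        x \<odot> x - (\<iota> (Complex a b) + \<iota> (Complex a (- b))) \<odot> x + \<iota> (Complex a b) \<odot> \<iota> (Complex a (- b))"
      by (simp add: mul_distribs D(1) mul_comm)
    also have "\<dots> = x \<odot> x - \<iota> (complex_of_real (2 * a)) \<odot> x + \<iota> (complex_of_real (a\<^sup>2 + b\<^sup>2))"
      unfolding D(2,3)[symmetric]
      by (intro arg_cong2[of _ _ _ _ "\<lambda>u v. x \<odot> x - \<iota> u \<odot> x + \<iota> v"])
        (simp_all add: complex_eq_iff power2_eq_square)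
    also have "\<dots> = x \<odot> x - (2 * a) *\<^sub>R x + (a\<^sup>2 + b\<^sup>2) *\<^sub>R \<one>"
      unfolding D(9) by simp
    finally have "nil ((x - \<iota> (Complex a b)) \<odot> (x - \<iota> (Complex a (- b))))"
      using ab by simp
    then show ?thesis
      using nil_mul_prime[of "x - \<iota> (Complex a b)" "x - \<iota> (Complex a (- b))"] D(1) by auto
  qed
  then have "residue_complex A \<iota>"
    using nontriv \<iota> by (simp add: residue_complex_def)
  then show ?thesis
    by (auto simp: unital_nil_algebra_def complex_nil_algebra_iff)
qed

end

end

section \<open>Decomposition into unital nil algebras\<close>

context fd_algebra
begin

text \<open>
  Splitting idempotents lowers the dimension of the corners, so it stops at corners without
  nontrivial idempotents.
\<close>

lemma idempotent_splitting:
  assumes "idem e"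
  shows "\<exists>S. finite S \<and> \<Sum>S = e \<and> (\<forall>s\<in>S. idem s \<and> s \<noteq> 0 \<and> e \<odot> s = s \<and> unital_nil_algebra (corner A s)) \<and>
    (\<forall>s\<in>S. \<forall>t\<in>S. s \<noteq> t \<longrightarrow> s \<odot> t = 0)"
  using assms
proof (induction "dim (carr (corner A e))" arbitrary: e rule: less_induct)
  case less
  note e = less.prems
  have ec [simp]: "e \<in> carr A" and ee [simp]: "e \<odot> e = e"
    using e by (simp_all add: idem_def)
  interpret C: fd_algebra "corner A e"
    by unfold_locales (rule is_algebra_corner[OF e])
  show ?case
  proof (cases "e = 0")
    case True
    then show ?thesis by (intro exI[of _ "{}"]) simp
  next
    case nz: False
    show ?thesis
    proof (cases "\<forall>f. C.idem f \<longrightarrow> f = 0 \<or> f = e")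
      case True
      then have "unital_nil_algebra (corner A e)"
        using nz by (intro C.connected_imp_unital_nil_algebra) simp_all
      then show ?thesis
        using nz e by (intro exI[of _ "{e}"]) simp
    next
      case False
      then obtain f where f [simp]: "f \<in> carr A" "f \<odot> f = f" "e \<odot> f = f" and fn: "f \<noteq> 0" "f \<noteq> e"
        by (auto simp: C.idem_def)
      have [simp]: "f \<odot> e = f"
        using mul_comm[of f e] by simp
      define g where "g = e - f"
      have g [simp]: "g \<in> carr A" "g \<odot> g = g" "e \<odot> g = g" "g \<odot> e = g" "f \<odot> g = 0" "g \<odot> f = 0"
        and gn: "g \<noteq> e"
        using fn by (simp_all add: g_def mul_distribs)
      have smaller: "dim (carr (corner A h)) < dim (carr (corner A e))"
        if h: "h \<in> carr A" "h \<odot> h = h" "e \<odot> h = h" "h \<noteq> e" for h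
      proof -
        interpret H: fd_algebra "corner A h"
          by unfold_locales (rule is_algebra_corner, use h in \<open>simp add: idem_def\<close>)
        have "e \<odot> x = x" if "x \<in> carr A" "h \<odot> x = x" for x
          using that h mul_assoc[of e h x] by simp
        then have "carr (corner A h) \<subseteq> carr (corner A e)"
          by auto
        moreover have "h \<odot> e = h"
          using h mul_comm[of h e] by simp
        then have "e \<in> carr (corner A e)" "e \<notin> carr (corner A h)"
          using h(4) by simp_all
        ultimately have "carr (corner A h) \<subset> carr (corner A e)"
          by blast
        then show ?thesis
          using H.subspace_carr C.subspace_carr by (metis dim_psubset span_eq_iff)
      qed
      obtain S where S: "finite S" "\<Sum>S = f"
          "\<And>s. s \<in> S \<Longrightarrow> idem s \<and> s \<noteq> 0 \<and> f \<odot> s = s \<and> unital_nil_algebra (corner A s)"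
          "\<And>s t. s \<in> S \<Longrightarrow> t \<in> S \<Longrightarrow> s \<noteq> t \<Longrightarrow> s \<odot> t = 0"
        using less.hyps[OF smaller[of f]] fn by (auto simp: idem_def)
      obtain T where T: "finite T" "\<Sum>T = g"
          "\<And>s. s \<in> T \<Longrightarrow> idem s \<and> s \<noteq> 0 \<and> g \<odot> s = s \<and> unital_nil_algebra (corner A s)"
          "\<And>s t. s \<in> T \<Longrightarrow> t \<in> T \<Longrightarrow> s \<noteq> t \<Longrightarrow> s \<odot> t = 0"
        using less.hyps[OF smaller[of g]] gn by (auto simp: idem_def)
      have cl: "s \<in> carr A" if "s \<in> S \<union> T" for s
        using that S(3) T(3) by (auto simp: idem_def)
      have orth: "s \<odot> t = 0" "t \<odot> s = 0" if s: "s \<in> S" and t: "t \<in> T" for s t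
      proof -
        have st: "s \<in> carr A" "t \<in> carr A"
          using cl s t by auto
        have "s \<odot> t = (f \<odot> s) \<odot> (g \<odot> t)"
          using S(3)[OF s] T(3)[OF t] by simp
        also have "\<dots> = (f \<odot> g) \<odot> (s \<odot> t)"
          by (simp only: mul_assoc mul_lcomm[OF st(1) g(1) st(2)] st f(1) g(1) carr_closed)
        finally show "s \<odot> t = 0"
          using st by simp
        then show "t \<odot> s = 0"
          using st by (simp add: mul_comm)
      qed
      have "S \<inter> T = {}"
        using orth(1) S(3) by (fastforce simp: idem_def)
      then have sum_e: "\<Sum>(S \<union> T) = e"
        using S(1,2) T(1,2) by (simp add: sum.union_disjoint g_def)
      have absorb: "e \<odot> s = s" if "s \<in> S \<union> T" for s
      proof -
        have "e \<odot> (f \<odot> s) = f \<odot> s" "e \<odot> (g \<odot> s) = g \<odot> s"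
          using mul_assoc[of e f s] mul_assoc[of e g s] cl[OF that] by simp_all
        then show ?thesis
          using that S(3) T(3) by auto
      qed
      have "\<forall>s\<in>S \<union> T. idem s \<and> s \<noteq> 0 \<and> e \<odot> s = s \<and> unital_nil_algebra (corner A s)"
        using S(3) T(3) absorb by blast
      moreover have "\<forall>s\<in>S \<union> T. \<forall>t\<in>S \<union> T. s \<noteq> t \<longrightarrow> s \<odot> t = 0"
        using S(4) T(4) orth by blast
      ultimately show ?thesis
        by (intro exI[of _ "S \<union> T"] conjI finite_UnI S(1) T(1) sum_e)
    qed
  qed
qed

lemma unit_splitting:
  obtains es where "distinct es" "\<And>s. s \<in> set es \<Longrightarrow> idem s" "\<And>s. s \<in> set es \<Longrightarrow> s \<noteq> 0"
    "\<And>s. s \<in> set es \<Longrightarrow> unital_nil_algebra (corner A s)"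
    "\<And>x. x \<in> carr A \<Longrightarrow> (\<Sum>s\<in>set es. s \<odot> x) = x"
    "\<And>s t. s \<in> set es \<Longrightarrow> t \<in> set es \<Longrightarrow> s \<noteq> t \<Longrightarrow> s \<odot> t = 0"
proof -
  obtain S where S: "finite S" "\<Sum>S = \<one>" "\<forall>s\<in>S. idem s \<and> s \<noteq> 0 \<and> \<one> \<odot> s = s \<and> unital_nil_algebra (corner A s)"
    "\<forall>s\<in>S. \<forall>t\<in>S. s \<noteq> t \<longrightarrow> s \<odot> t = 0"
    using idempotent_splitting[of \<one>] by (auto simp: idem_def)
  obtain es where es: "set es = S" "distinct es"
    using finite_distinct_list[OF S(1)] by blast
  have "(\<Sum>s\<in>S. s \<odot> x) = x" if "x \<in> carr A" for x
    using mul_sum_left[of x S "\<lambda>s. s"] that S by (simp add: idem_def)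
  then show thesis
    using S es by (intro that[of es]) auto
qed

lemma ex_nil_decomposition: "\<exists>Ns Rs Cs \<phi>. nil_decomposition A Ns Rs Cs \<phi>"
proof -
  obtain es where es: "distinct es" "\<And>s. s \<in> set es \<Longrightarrow> idem s"
      "\<And>s. s \<in> set es \<Longrightarrow> unital_nil_algebra (corner A s)"
      "\<And>x. x \<in> carr A \<Longrightarrow> (\<Sum>s\<in>set es. s \<odot> x) = x"
      "\<And>s t. s \<in> set es \<Longrightarrow> t \<in> set es \<Longrightarrow> s \<noteq> t \<Longrightarrow> s \<odot> t = 0"
    using unit_splitting by metis
  let ?n = "length es"
  let ?Fs = "map (corner A) es" and ?\<phi> = "\<lambda>i x. es ! i \<odot> x"
  have esc: "es ! i \<in> carr A" "es ! i \<odot> es ! i = es ! i" if "i < ?n" for i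
    using es(2)[of "es ! i"] that by (auto simp: idem_def)
  have expand: "(\<Sum>i<?n. es ! i \<odot> x) = x" if "x \<in> carr A" for x
    using es(4)[OF that] es(1) by (simp add: sum.distinct_set_conv_list sum_list_sum_nth atLeast0LessThan)
  have "bij_betw (\<lambda>x. \<lambda>i\<in>{..<?n}. ?\<phi> i x) (carr A) (\<Pi>\<^sub>E i\<in>{..<?n}. carr (corner A (es ! i)))"
  proof (rule bij_betw_byWitness[where f' = "\<lambda>y. \<Sum>i<?n. y i"])
    show "\<forall>x\<in>carr A. (\<Sum>i<?n. (\<lambda>i\<in>{..<?n}. ?\<phi> i x) i) = x"
      by (simp add: expand)
    show "(\<lambda>x. \<lambda>i\<in>{..<?n}. ?\<phi> i x) ` carr A \<subseteq> (\<Pi>\<^sub>E i\<in>{..<?n}. carr (corner A (es ! i)))"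
      using es(2) by (auto simp only: restrict_PiE_iff image_subset_iff corner_sel mem_Collect_eq
          idem_absorb carr_closed esc lessThan_iff nth_mem)
    show "(\<lambda>y. \<Sum>i<?n. y i) ` (\<Pi>\<^sub>E i\<in>{..<?n}. carr (corner A (es ! i))) \<subseteq> carr A"
      by (auto intro!: sum_closed simp: PiE_iff)
    show "\<forall>y\<in>\<Pi>\<^sub>E i\<in>{..<?n}. carr (corner A (es ! i)). (\<lambda>i\<in>{..<?n}. ?\<phi> i (\<Sum>i<?n. y i)) = y"
    proof
      fix y assume y: "y \<in> (\<Pi>\<^sub>E i\<in>{..<?n}. carr (corner A (es ! i)))"
      have yc: "y i \<in> carr A" "es ! i \<odot> y i = y i" if "i < ?n" for i
        using y that by (auto simp: PiE_iff)
      have orth: "es ! i \<odot> y j = (if i = j then y j else 0)" if "i < ?n" "j < ?n" for i j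
      proof (cases "i = j")
        case False
        then have "es ! i \<odot> es ! j = 0"
          using es(1,5) that by (simp add: nth_eq_iff_index_eq)
        then have "es ! i \<odot> (es ! j \<odot> y j) = 0"
          using mul_assoc[of "es ! i" "es ! j" "y j"] esc yc that by simp
        then show ?thesis
          using False yc that by simp
      qed (use yc that in simp)
      have "?\<phi> i (\<Sum>j<?n. y j) = y i" if "i < ?n" for i
      proof -
        have "?\<phi> i (\<Sum>j<?n. y j) = (\<Sum>j<?n. es ! i \<odot> y j)"
          using that yc esc by (intro mul_sum_right) simp_all
        also have "\<dots> = (\<Sum>j<?n. if i = j then y j else 0)"
          using that orth by (intro sum.cong) simp_all
        finally show ?thesis
          using that by simp
      qed
      then show "(\<lambda>i\<in>{..<?n}. ?\<phi> i (\<Sum>i<?n. y i)) = y"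
        using y by (intro PiE_ext[of _ "{..<?n}" "\<lambda>_. UNIV"]) (auto simp: PiE_iff)
    qed
  qed
  moreover have "(\<Pi>\<^sub>E i\<in>{..<?n}. carr (corner A (es ! i))) = (\<Pi>\<^sub>E i\<in>{..<?n}. carr (?Fs ! i))"
    by (rule PiE_cong) simp
  \<comment> \<open>Copies of \<open>\<real>\<close> and \<open>\<complex>\<close> are unital nil algebras as well and stay in the first list.\<close>
  ultimately have "nil_decomposition A ?Fs [] [] ?\<phi>"
    using es(2,3) is_algebra_corner corner_hom
    by (simp add: nil_decomposition_def alg_decomposition_def)
  then show ?thesis by blast
qed

end

lemma complex_nil_algebra_imp_type_C:
  assumes "complex_nil_algebra A"
  shows "type_C A"
proof -
  have A: "is_algebra A"
    using assms by (simp add: complex_nil_algebra_def)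
  interpret fd_algebra A by unfold_locales (rule A)
  have "\<one> \<noteq> 0"
    using assms by (auto simp: complex_nil_algebra_iff residue_complex_def)
  then show ?thesis
    using A assms nontrivial by (simp add: type_C_def)
qed

text \<open>
  Real unital nil algebras have no nonzero periods.
\<close>

lemma unital_nil_algebra_period_imp_complex_nil:
  assumes "unital_nil_algebra A" "z \<in> carr A" "z \<noteq> 0" "alg_exp A z = uni A"
  shows "complex_nil_algebra A"
proof -
  have "is_algebra A"
    using assms(1) by (auto simp: unital_nil_algebra_def real_nil_algebra_def complex_nil_algebra_def)
  then interpret fd_algebra A by unfold_locales
  show ?thesis
    using assms residue_real_exp_eq_unit by (auto simp: unital_nil_algebra_def real_nil_algebra_iff)
qed

lemma unital_nil_algebra_type_C_imp_complex_nil: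
  assumes "unital_nil_algebra A" "type_C A"
  shows "complex_nil_algebra A"
  using assms type_C_period unital_nil_algebra_period_imp_complex_nil by metis

section \<open>Type-R algebras are those without nonzero periods\<close>

lemma alg_hom_pair:
  "alg_hom A B f \<Longrightarrow> alg_hom A C g \<Longrightarrow> alg_hom A (prod_alg B C) (\<lambda>x. (f x, g x))"
  by (auto simp: alg_hom_def prod_alg_def)

lemma (in fd_algebra) alg_iso_corners:
  assumes e: "idem e"
  shows "alg_iso A (prod_alg (corner A (\<one> - e)) (corner A e))"
proof -
  have ec [simp]: "e \<in> carr A" "e \<odot> e = e"
    using e by (simp_all add: idem_def)
  let ?f = "\<lambda>x. ((\<one> - e) \<odot> x, e \<odot> x)"
  have orth: "(\<one> - e) \<odot> x = 0" if "x \<in> carr A" "e \<odot> x = x" for x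
    using that by (simp add: mul_distribs)
  have "alg_hom A (prod_alg (corner A (\<one> - e)) (corner A e)) ?f"
    by (intro alg_hom_pair corner_hom e idem_complement)
  moreover have "bij_betw ?f (carr A) (carr (prod_alg (corner A (\<one> - e)) (corner A e)))"
  proof (rule bij_betw_byWitness[where f' = "\<lambda>(u, v). u + v"])
    show "\<forall>x\<in>carr A. (case ?f x of (u, v) \<Rightarrow> u + v) = x"
      by (simp add: mul_distribs)
    show "\<forall>y\<in>carr (prod_alg (corner A (\<one> - e)) (corner A e)). ?f (case y of (u, v) \<Rightarrow> u + v) = y"
    proof
      fix y assume "y \<in> carr (prod_alg (corner A (\<one> - e)) (corner A e))"
      then obtain u v where y: "y = (u, v)" "u \<in> carr A" "v \<in> carr A" "(\<one> - e) \<odot> u = u" "e \<odot> v = v"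
        by (auto simp: prod_alg_def)
      have "e \<odot> u = 0"
        using y by (simp add: mul_distribs)
      then show "?f (case y of (u, v) \<Rightarrow> u + v) = y"
        using y orth[of v] by (simp add: mul_add_right)
    qed
    show "?f ` carr A \<subseteq> carr (prod_alg (corner A (\<one> - e)) (corner A e))"
      using e idem_complement[OF e] by (auto simp: prod_alg_def)
    show "(\<lambda>(u, v). u + v) ` carr (prod_alg (corner A (\<one> - e)) (corner A e)) \<subseteq> carr A"
      by (auto simp: prod_alg_def)
  qed
  ultimately show ?thesis
    by (auto simp: alg_iso_def)
qed

text \<open>
  A nonzero period has a nonzero component in some factor. That factor is then complex, hence type-C.
\<close>

lemma (in fd_algebra) type_R_imp_exp_inj:
  assumes R: "type_R A"
  shows "inj_on (alg_exp A) (carr A)"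
  unfolding exp_inj_iff
proof (intro ballI impI, rule ccontr)
  fix z assume z: "z \<in> carr A" "alg_exp A z = \<one>" "z \<noteq> 0"
  obtain es where es: "\<And>s. s \<in> set es \<Longrightarrow> idem s"
      "\<And>s. s \<in> set es \<Longrightarrow> unital_nil_algebra (corner A s)"
      "\<And>x. x \<in> carr A \<Longrightarrow> (\<Sum>s\<in>set es. s \<odot> x) = x"
    using unit_splitting by metis
  have "(\<Sum>s\<in>set es. s \<odot> z) \<noteq> 0"
    using es(3)[OF z(1)] z(3) by simp
  then obtain s where s: "s \<in> set es" "s \<odot> z \<noteq> 0"
    by (metis sum.neutral)
  note i = es(1)[OF s(1)]
  have "alg_exp (corner A s) (s \<odot> z) = uni (corner A s)"
    using exp_corner[OF i z(1)] z(2) i by (simp add: idem_def)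
  moreover have "s \<odot> z \<in> carr (corner A s)"
    using i z(1) by (simp add: idem_def flip: mul_assoc)
  ultimately have "complex_nil_algebra (corner A s)"
    using unital_nil_algebra_period_imp_complex_nil[OF es(2)[OF s(1)]] s(2) by blast
  then have "type_C (corner A s)"
    by (rule complex_nil_algebra_imp_type_C)
  then show False
    using R is_algebra_corner[OF idem_complement[OF i]] alg_iso_corners[OF i]
    unfolding type_R_def by blast
qed

text \<open>
  A period of a direct factor, extended by \<open>0\<close>, is a period of the product.
\<close>

lemma (in fd_algebra) not_type_R_period:
  assumes "\<not> type_R A"
  obtains z where "z \<in> carr A" "z \<noteq> 0" "alg_exp A z = \<one>"
proof -
  obtain B C :: "'a alg" and f where B: "is_algebra B" and C: "type_C C"
    and f: "alg_hom A (prod_alg B C) f" "bij_betw f (carr A) (carr (prod_alg B C))"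
    using assms unfolding type_R_def alg_iso_def by blast
  obtain p where p: "p \<in> carr C" "p \<noteq> 0" "alg_exp C p = uni C"
    using type_C_period[OF C] by blast
  have C': "is_algebra C"
    using C by (simp add: type_C_def)
  interpret B: fd_algebra B by unfold_locales (rule B)
  interpret C: fd_algebra C by unfold_locales (rule C')
  have P: "is_algebra (prod_alg B C)"
    by (auto simp: is_algebra_def prod_alg_def B.mul_ac C.mul_ac B.mul_distribs C.mul_distribs
        intro!: subspace_Times B.subspace_carr C.subspace_carr)
  have homs: "alg_hom (prod_alg B C) B fst" "alg_hom (prod_alg B C) C snd"
    by (auto simp: alg_hom_def prod_alg_def)
  have p': "(0, p) \<in> carr (prod_alg B C)"
    using p(1) by (simp add: prod_alg_def)
  then obtain z where z: "z \<in> carr A" "f z = (0, p)"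
    using f(2) by (metis bij_betw_imp_surj_on imageE)
  have "fst (alg_exp (prod_alg B C) (0, p)) = uni B" "snd (alg_exp (prod_alg B C) (0, p)) = uni C"
    using hom_exp[OF P B homs(1) p'] hom_exp[OF P C' homs(2) p'] p(3) by simp_all
  then have "alg_exp (prod_alg B C) (0, p) = uni (prod_alg B C)"
    by (simp add: prod_alg_def prod_eq_iff)
  then have "f (alg_exp A z) = f \<one>"
    using hom_exp[OF is_algebra P f(1) z(1)] z(2) alg_homD(5)[OF f(1) z(1)] by simp
  then have "alg_exp A z = \<one>"
    using f(2) z(1) by (auto simp: bij_betw_def dest: inj_onD)
  moreover have "z \<noteq> 0"
    using z(2) p(2) hom_0[OF is_algebra P f(1)] by (auto simp: zero_prod_def)
  ultimately show thesis
    using that z(1) by blast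
qed

section \<open>Logarithms\<close>

lemma Ld_I: "x \<in> carr A \<Longrightarrow> alg_exp A x \<in> Ld A"
  by (simp add: Ld_def)

lemma ex1_exp_inverse:
  assumes inj: "inj_on (alg_exp A) (carr A)"
  shows "\<exists>!l. exp_inverse A l"
proof (rule ex_ex1I)
  let ?l = "\<lambda>z\<in>Ld A. inv_into (carr A) (alg_exp A) z"
  have "inv_into (carr A) (alg_exp A) z \<in> carr A" "alg_exp A (inv_into (carr A) (alg_exp A) z) = z"
    if "z \<in> Ld A" for z
    using that by (simp_all add: Ld_def inv_into_into f_inv_into_f)
  moreover have "?l (alg_exp A z) = z" if "z \<in> carr A" for z
    using that inj by (simp add: Ld_I inv_into_f_f)
  ultimately have "exp_inverse A ?l"
    by (simp add: exp_inverse_def restrict_PiE_iff)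
  then show "\<exists>l. exp_inverse A l" by blast
next
  fix l l' assume "exp_inverse A l" "exp_inverse A l'"
  then show "l = l'"
    by (intro PiE_ext[of l "Ld A" "\<lambda>_. carr A" l']) (auto simp: exp_inverse_def Ld_def)
qed

text \<open>
  In the coordinates \<open>h\<close> the periods of the exponential form the lattice of all integral multiples of
  \<open>2 * pi\<close>, so a half-open cube with edges of length \<open>2 * pi\<close> in these coordinates is a fundamental
  domain; it is convex, hence connected. Moving the cube gives infinitely many logarithms.
\<close>

lemma (in fd_algebra) infinite_logarithms:
  fixes h :: "'i \<Rightarrow> 'a \<Rightarrow> real"
  assumes J: "J \<noteq> {}"
    and add: "\<And>j x y. j \<in> J \<Longrightarrow> x \<in> carr A \<Longrightarrow> y \<in> carr A \<Longrightarrow> h j (x + y) = h j x + h j y"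
    and scale: "\<And>j x r. j \<in> J \<Longrightarrow> x \<in> carr A \<Longrightarrow> h j (r *\<^sub>R x) = r * h j x"
    and periods: "\<And>k :: 'i \<Rightarrow> int. \<exists>p\<in>carr A. alg_exp A p = \<one> \<and> (\<forall>j\<in>J. h j p = 2 * pi * k j)"
    and kernel: "\<And>z. z \<in> carr A \<Longrightarrow> alg_exp A z = \<one> \<Longrightarrow>
      (\<forall>j\<in>J. \<exists>m :: int. h j z = 2 * pi * m) \<and> ((\<forall>j\<in>J. h j z = 0) \<longrightarrow> z = 0)"
  shows "infinite (logarithms A)"
proof -
  define B where "B \<theta> = {x \<in> carr A. \<forall>j\<in>J. \<theta> \<le> h j x \<and> h j x < \<theta> + 2 * pi}" for \<theta>
  have diff: "h j (x - y) = h j x - h j y" if "j \<in> J" "x \<in> carr A" "y \<in> carr A" for j x y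
    using add[of j x "- y"] scale[of j y "- 1"] that by simp
  have "convex (B \<theta>)" for \<theta>
    unfolding convex_def
  proof (intro ballI allI impI)
    fix x y and u v :: real
    assume x: "x \<in> B \<theta>" and y: "y \<in> B \<theta>" and uv: "0 \<le> u" "0 \<le> v" "u + v = 1"
    have "\<theta> \<le> u * a + v * b \<and> u * a + v * b < \<theta> + 2 * pi"
      if "\<theta> \<le> a" "a < \<theta> + 2 * pi" "\<theta> \<le> b" "b < \<theta> + 2 * pi" for a b
      using convexD[OF convex_real_interval(7), of a \<theta> "\<theta> + 2 * pi" b u v] that uv by simp
    then show "u *\<^sub>R x + v *\<^sub>R y \<in> B \<theta>"
      using x y by (simp add: B_def add scale)
  qed
  then have conn: "connected (B \<theta>)" for \<theta>
    by (rule convex_connected)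
  have inj: "inj_on (alg_exp A) (B \<theta>)" for \<theta>
  proof (rule inj_onI)
    fix x y assume x: "x \<in> B \<theta>" and y: "y \<in> B \<theta>" and eq: "alg_exp A x = alg_exp A y"
    have xy: "x \<in> carr A" "y \<in> carr A"
      using x y by (simp_all add: B_def)
    have ker: "alg_exp A (x - y) = \<one>"
      using eq exp_eq_iff xy by blast
    have "h j (x - y) = 0" if j: "j \<in> J" for j
    proof -
      obtain m :: int where m: "h j (x - y) = 2 * pi * m"
        using kernel[OF _ ker] j xy by auto
      have "\<bar>h j (x - y)\<bar> < 2 * pi"
      proof -
        have "\<theta> \<le> h j x" "h j x < \<theta> + 2 * pi" "\<theta> \<le> h j y" "h j y < \<theta> + 2 * pi"
          using x y j by (simp_all add: B_def)
        then show ?thesis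
          using diff[OF j xy] by linarith
      qed
      then have "2 * pi * \<bar>real_of_int m\<bar> < 2 * pi * 1"
        by (simp add: m abs_mult)
      then have "\<bar>real_of_int m\<bar> < 1"
        by (simp only: mult_less_cancel_left_pos pi_gt_zero zero_less_mult_iff zero_less_numeral simp_thms)
      then have "m = 0"
        by linarith
      then show ?thesis
        using m by simp
    qed
    then have "x - y = 0"
      using kernel[OF _ ker] xy by simp
    then show "x = y" by simp
  qed
  have onto: "alg_exp A ` B \<theta> = Ld A" for \<theta>
  proof
    show "alg_exp A ` B \<theta> \<subseteq> Ld A"
      by (auto simp: B_def Ld_def)
    show "Ld A \<subseteq> alg_exp A ` B \<theta>"
    proof
      fix z assume "z \<in> Ld A"
      then obtain x where x: "x \<in> carr A" "z = alg_exp A x"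
        by (auto simp: Ld_def)
      \<comment> \<open>the translation that moves each coordinate into the half-open interval\<close>
      define k where "k j = - \<lfloor>(h j x - \<theta>) / (2 * pi)\<rfloor>" for j
      obtain p where p: "p \<in> carr A" "alg_exp A p = \<one>" "\<And>j. j \<in> J \<Longrightarrow> h j p = 2 * pi * k j"
        using periods[of k] by blast
      have "\<theta> \<le> h j (x + p) \<and> h j (x + p) < \<theta> + 2 * pi" if j: "j \<in> J" for j
      proof -
        let ?q = "(h j x - \<theta>) / (2 * pi)"
        have q: "h j x = \<theta> + 2 * pi * ?q"
          by simp
        have "h j (x + p) = \<theta> + 2 * pi * (?q - \<lfloor>?q\<rfloor>)"
          using q j x p by (simp add: add k_def algebra_simps)
        moreover have "0 \<le> ?q - \<lfloor>?q\<rfloor>" "?q - \<lfloor>?q\<rfloor> < 1"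
          by linarith+
        then have "0 \<le> 2 * pi * (?q - \<lfloor>?q\<rfloor>)" "2 * pi * (?q - \<lfloor>?q\<rfloor>) < 2 * pi * 1"
          by (simp_all only: mult_less_cancel_left_pos zero_le_mult_iff pi_gt_zero zero_less_mult_iff
              zero_less_numeral pi_ge_zero zero_le_numeral simp_thms)
        ultimately show ?thesis by linarith
      qed
      then have "x + p \<in> B \<theta>"
        using x p by (simp add: B_def)
      moreover have "z = alg_exp A (x + p)"
        using x p by (simp add: exp_add)
      ultimately show "z \<in> alg_exp A ` B \<theta>" by blast
    qed
  qed
  define L where "L \<theta> = (\<lambda>z\<in>Ld A. inv_into (B \<theta>) (alg_exp A) z)" for \<theta>
  have "(B \<theta>, L \<theta>) \<in> logarithms A" for \<theta>
  proof -
    have "inv_into (B \<theta>) (alg_exp A) z \<in> B \<theta>" "alg_exp A (inv_into (B \<theta>) (alg_exp A) z) = z"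
      if "z \<in> Ld A" for z
      using that onto[of \<theta>] by (auto intro: inv_into_into f_inv_into_f)
    moreover have "L \<theta> (alg_exp A x) = x" if "x \<in> B \<theta>" for x
      using that inj[of \<theta>] by (simp add: L_def B_def Ld_I)
    moreover have "B \<theta> \<subseteq> carr A"
      by (auto simp: B_def)
    ultimately show ?thesis
      using conn inj onto by (simp add: logarithms_def) (simp add: L_def)
  qed
  then have range: "range (\<lambda>\<theta>. (B \<theta>, L \<theta>)) \<subseteq> logarithms A"
    by blast
  have "inj (\<lambda>\<theta>. (B \<theta>, L \<theta>))"
  proof (rule linorder_injI)
    fix \<theta> \<theta>' :: real assume "\<theta> < \<theta>'"
    obtain j where j: "j \<in> J" using J by blast
    obtain p where p: "p \<in> carr A" "\<And>j. j \<in> J \<Longrightarrow> h j p = 2 * pi"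
      using periods[of "\<lambda>_. 1"] by auto
    have "h j ((\<theta> / (2 * pi)) *\<^sub>R p) = \<theta>" if "j \<in> J" for j
      using that p by (simp add: scale)
    then have "(\<theta> / (2 * pi)) *\<^sub>R p \<in> B \<theta>" "(\<theta> / (2 * pi)) *\<^sub>R p \<notin> B \<theta>'"
      using p j \<open>\<theta> < \<theta>'\<close> by (auto simp: B_def)
    then show "(B \<theta>, L \<theta>) \<noteq> (B \<theta>', L \<theta>')"
      by auto
  qed
  then have "infinite (range (\<lambda>\<theta>. (B \<theta>, L \<theta>)))"
    using infinite_UNIV_char_0 finite_imageD by blast
  then show ?thesis
    using range finite_subset by blast
qed

section \<open>Lifting logarithms from a direct factor\<close>

text \<open>
  With respect to the Peirce decomposition \<open>x = (1 - e) x + e x\<close> the exponential acts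
  componentwise. If it is injective on the first component, the first component of a logarithm is
  forced, and each branch on the second component extends to a logarithm of the whole algebra.
\<close>

lemma (in fd_algebra) logs_determined_by_corner:
  assumes e: "idem e"
    and inj: "inj_on (alg_exp (corner A (\<one> - e))) (carr (corner A (\<one> - e)))"
    and inf: "infinite (logarithms (corner A e))"
  shows "logs_determined_by A (corner A (\<one> - e)) (corner A e)"
proof -
  let ?P = "corner A (\<one> - e)" and ?Q = "corner A e"
  let ?p = "\<lambda>x. (\<one> - e) \<odot> x" and ?q = "\<lambda>x. e \<odot> x"
  have ec [simp]: "e \<in> carr A" "e \<odot> e = e"
    using e by (simp_all add: idem_def)
  have p_carr: "?p x \<in> carr ?P" and q_carr: "?q x \<in> carr ?Q" if "x \<in> carr A" for x
    using that e idem_complement[OF e] by simp_all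
  have carrD: "x \<in> carr A" if "x \<in> carr ?P \<or> x \<in> carr ?Q" for x
    using that by auto
  have pq: "?p x + ?q x = x" if "x \<in> carr A" for x
    using that by (simp add: mul_distribs)
  have p_add: "?p (u + v) = u" and q_add: "?q (u + v) = v" if u: "u \<in> carr ?P" and v: "v \<in> carr ?Q" for u v
  proof -
    have uv: "u \<in> carr A" "v \<in> carr A" "(\<one> - e) \<odot> u = u" "e \<odot> v = v"
      using u v by simp_all
    then have "e \<odot> u = 0"
      by (simp add: mul_diff_left)
    with uv show "?p (u + v) = u" "?q (u + v) = v"
      by (simp_all add: mul_distribs)
  qed
  have exp_p: "alg_exp ?P (?p x) = ?p (alg_exp A x)" and exp_q: "alg_exp ?Q (?q x) = ?q (alg_exp A x)"
    if "x \<in> carr A" for x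
    using that e idem_complement[OF e] by (simp_all only: exp_corner)
  have p_Ld: "?p z \<in> Ld ?P" and q_Ld: "?q z \<in> Ld ?Q" if "z \<in> Ld A" for z
    using that p_carr q_carr by (auto simp only: Ld_def exp_p[symmetric] exp_q[symmetric])
  have Ld_carr: "z \<in> carr A" if "z \<in> Ld A" for z
    using that by (auto simp: Ld_def)
  have eqI: "x = y" if "x \<in> carr A" "y \<in> carr A" "?p x = ?p y" "?q x = ?q y" for x y
    using pq that by metis
  obtain L where L: "exp_inverse ?P L"
    using ex1_exp_inverse[OF inj] by blast
  have L_carr: "L z \<in> carr ?P" and exp_L: "alg_exp ?P (L z) = z" if "z \<in> Ld ?P" for z
    using L that by (auto simp only: exp_inverse_def PiE_iff)
  have L_exp: "L (alg_exp ?P x) = x" if "x \<in> carr ?P" for x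
    using L that by (simp only: exp_inverse_def)
  have lift: "lift_log A ?P ?Q L (B, l) =
      ({x \<in> carr A. ?q x \<in> B}, \<lambda>z\<in>Ld A. L (?p z) + l (?q z))" for B l
    by (simp add: lift_log_def proj_def)
  have lift_log: "lift_log A ?P ?Q L (B, l) \<in> logarithms A" if Bl: "(B, l) \<in> logarithms ?Q" for B l
  proof -
    have B: "B \<subseteq> carr ?Q" "connected B" "inj_on (alg_exp ?Q) B" "alg_exp ?Q ` B = Ld ?Q"
      and l: "l \<in> Ld ?Q \<rightarrow>\<^sub>E B" "\<And>z. z \<in> B \<Longrightarrow> l (alg_exp ?Q z) = z"
        "\<And>z. z \<in> Ld ?Q \<Longrightarrow> alg_exp ?Q (l z) = z"
      using Bl by (simp_all only: logarithms_def mem_Collect_eq prod.case)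
    have l_B: "l z \<in> B" "l z \<in> carr ?Q" if "z \<in> Ld ?Q" for z
      using l(1) B(1) that by (auto simp only: PiE_iff)
    let ?B = "{x \<in> carr A. ?q x \<in> B}" and ?l = "\<lambda>z\<in>Ld A. L (?p z) + l (?q z)"
    have sum_B: "u + v \<in> ?B" if "u \<in> carr ?P" "v \<in> B" for u v
    proof -
      note v = subsetD[OF B(1) that(2)]
      have "u \<in> carr A" "v \<in> carr A"
        using carrD that(1) v by blast+
      then show ?thesis
        using q_add[OF that(1) v] that(2) by (simp only: mem_Collect_eq carr_closed simp_thms)
    qed
    have "?B = (\<lambda>(u, v). u + v) ` (carr ?P \<times> B)"
    proof
      show "?B \<subseteq> (\<lambda>(u, v). u + v) ` (carr ?P \<times> B)"
      proof
        fix x assume "x \<in> ?B"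
        then have x: "x \<in> carr A" "?q x \<in> B"
          by simp_all
        show "x \<in> (\<lambda>(u, v). u + v) ` (carr ?P \<times> B)"
          by (rule image_eqI[of _ _ "(?p x, ?q x)"]) (simp_all only: prod.case pq[OF x(1)] mem_Sigma_iff
              p_carr[OF x(1)] x(2) simp_thms)
      qed
      show "(\<lambda>(u, v). u + v) ` (carr ?P \<times> B) \<subseteq> ?B"
        using sum_B by auto
    qed
    moreover have "connected (carr ?P)"
      using is_algebra_corner[OF idem_complement[OF e]]
      by (simp only: is_algebra_def subspace_imp_convex convex_connected)
    then have "connected ((\<lambda>(u, v). u + v) ` (carr ?P \<times> B))"
      using B(2)
      by (intro connected_continuous_image connected_Times)
        (simp_all add: case_prod_unfold continuous_intros)
    ultimately have conn: "connected ?B" by simp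
    have inj_B: "inj_on (alg_exp A) ?B"
    proof (rule inj_onI)
      fix x y assume x: "x \<in> ?B" and y: "y \<in> ?B" and eq: "alg_exp A x = alg_exp A y"
      have xy: "x \<in> carr A" "y \<in> carr A" "?q x \<in> B" "?q y \<in> B"
        using x y by simp_all
      have "?p x = ?p y"
        using inj_onD[OF inj, of "?p x" "?p y"] exp_p eq xy p_carr by simp
      moreover have "?q x = ?q y"
        using inj_onD[OF B(3), of "?q x" "?q y"] exp_q eq xy by simp
      ultimately show "x = y"
        using eqI xy by blast
    qed
    have l_in: "L (?p z) + l (?q z) \<in> ?B" if "z \<in> Ld A" for z
      using that sum_B L_carr p_Ld l_B(1) q_Ld by blast
    have exp_l: "alg_exp A (L (?p z) + l (?q z)) = z" if z: "z \<in> Ld A" for z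
    proof (rule eqI)
      let ?w = "L (?p z) + l (?q z)"
      have w: "?w \<in> carr A"
        using l_in[OF z] by simp
      have "?p ?w = L (?p z)" "?q ?w = l (?q z)"
        using p_add q_add L_carr p_Ld l_B(2) q_Ld z by blast+
      then show "?p (alg_exp A ?w) = ?p z" "?q (alg_exp A ?w) = ?q z"
        using exp_p[OF w] exp_q[OF w] exp_L[OF p_Ld[OF z]] l(3)[OF q_Ld[OF z]] by simp_all
      show "alg_exp A ?w \<in> carr A" "z \<in> carr A"
        using w Ld_carr[OF z] by simp_all
    qed
    have onto: "alg_exp A ` ?B = Ld A"
    proof
      show "alg_exp A ` ?B \<subseteq> Ld A"
        by (rule image_subsetI) (simp add: Ld_I)
      show "Ld A \<subseteq> alg_exp A ` ?B"
      proof
        fix z assume z: "z \<in> Ld A"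
        show "z \<in> alg_exp A ` ?B"
          by (rule rev_image_eqI[OF l_in[OF z]]) (rule exp_l[OF z, symmetric])
      qed
    qed
    have "?l (alg_exp A x) = x" if x: "x \<in> ?B" for x
    proof -
      have xc: "x \<in> carr A" "?q x \<in> B"
        using x by simp_all
      have "L (?p (alg_exp A x)) = ?p x" "l (?q (alg_exp A x)) = ?q x"
        using L_exp[OF p_carr[OF xc(1)]] l(2)[OF xc(2)] exp_p[OF xc(1)] exp_q[OF xc(1)] by simp_all
      then show ?thesis
        using pq xc Ld_I[OF xc(1)] by simp
    qed
    moreover have "?l \<in> Ld A \<rightarrow>\<^sub>E ?B"
      using l_in by (simp only: restrict_PiE_iff) blast
    ultimately show ?thesis
      using conn inj_B onto exp_l unfolding lift logarithms_def by auto
  qed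
  have "inj_on (lift_log A ?P ?Q L) (logarithms ?Q)"
  proof (rule inj_onI, clarify)
    fix B l B' l'
    assume Bl: "(B, l) \<in> logarithms ?Q" and Bl': "(B', l') \<in> logarithms ?Q"
      and eq: "lift_log A ?P ?Q L (B, l) = lift_log A ?P ?Q L (B', l')"
    have sub: "B \<subseteq> carr ?Q" "B' \<subseteq> carr ?Q" and l: "l \<in> Ld ?Q \<rightarrow>\<^sub>E B" "l' \<in> Ld ?Q \<rightarrow>\<^sub>E B'"
      using Bl Bl' by (simp_all only: logarithms_def mem_Collect_eq prod.case)
    have eq1: "{x \<in> carr A. ?q x \<in> B} = {x \<in> carr A. ?q x \<in> B'}"
      and eq2: "(\<lambda>z\<in>Ld A. L (?p z) + l (?q z)) = (\<lambda>z\<in>Ld A. L (?p z) + l' (?q z))"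
      using eq by (simp_all only: lift prod.inject)
    have "v \<in> B \<longleftrightarrow> v \<in> B'" if "v \<in> carr ?Q" for v
    proof -
      have "v \<in> {x \<in> carr A. ?q x \<in> B} \<longleftrightarrow> v \<in> {x \<in> carr A. ?q x \<in> B'}"
        by (simp only: eq1)
      then show ?thesis
        using that by simp
    qed
    then have "B = B'"
      using sub by blast
    moreover have "l v = l' v" if v: "v \<in> Ld ?Q" for v
    proof -
      obtain x where x: "x \<in> carr ?Q" "v = alg_exp ?Q x"
        using v by (auto simp only: Ld_def)
      then have "v = ?q (alg_exp A x)"
        using exp_q[of x] by simp
      moreover have "l (?q (alg_exp A x)) = l' (?q (alg_exp A x))"
        using fun_cong[OF eq2, of "alg_exp A x"] x Ld_I[of x A] by simp
      ultimately show ?thesis by simp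
    qed
    then have "l = l'"
      using l by (intro PiE_ext[of l "Ld ?Q" "\<lambda>_. UNIV" l']) (auto simp only: PiE_iff UNIV_I)
    ultimately show "B = B' \<and> l = l'" by blast
  qed
  moreover have "\<forall>(B, l)\<in>logarithms A. \<forall>z\<in>Ld A.
      proj A ?P (l z) = L (proj A ?P z) \<and> alg_exp ?Q (proj A ?Q (l z)) = proj A ?Q z"
  proof (clarify, intro conjI)
    fix B l z assume Bl: "(B, l) \<in> logarithms A" and z: "z \<in> Ld A"
    have l: "l z \<in> carr A" "alg_exp A (l z) = z"
      using Bl z by (auto simp: logarithms_def PiE_iff)
    show "proj A ?P (l z) = L (proj A ?P z)"
      using L_exp[OF p_carr[OF l(1)]] exp_p[OF l(1)] l(2) by (simp add: proj_def)
    show "alg_exp ?Q (proj A ?Q (l z)) = proj A ?Q z"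
      using exp_q[OF l(1)] l(2) by (simp add: proj_def)
  qed
  moreover have "lift_log A ?P ?Q L ` logarithms ?Q \<subseteq> logarithms A"
    using lift_log by auto
  ultimately show ?thesis
    unfolding logs_determined_by_def using L inf by blast
qed

lemma logs_determined_by_infinite:
  assumes "logs_determined_by A P Q"
  shows "infinite (logarithms A)"
proof -
  obtain L where "infinite (logarithms Q)" "lift_log A P Q L ` logarithms Q \<subseteq> logarithms A"
    "inj_on (lift_log A P Q L) (logarithms Q)"
    using assms unfolding logs_determined_by_def by blast
  then show ?thesis
    using finite_imageD finite_subset by blast
qed

section \<open>Portions of a decomposition\<close>

locale decomposed_algebra = fd_algebra A for A :: "('a::euclidean_space) alg" +
  fixes Fs :: "'a alg list" and \<phi> :: "nat \<Rightarrow> 'a \<Rightarrow> 'a"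
  assumes dec: "alg_decomposition A Fs \<phi>"
begin

abbreviation I where "I \<equiv> {..<length Fs}"

lemma factor_algebra: "i \<in> I \<Longrightarrow> is_algebra (Fs ! i)"
  and factor_hom: "i \<in> I \<Longrightarrow> alg_hom A (Fs ! i) (\<phi> i)"
  using dec by (simp_all add: alg_decomposition_def)

lemmas factor_homD = alg_homD[OF factor_hom]

lemma components_inject:
  assumes "x \<in> carr A" "y \<in> carr A" "\<And>i. i \<in> I \<Longrightarrow> \<phi> i x = \<phi> i y"
  shows "x = y"
proof (rule inj_onD)
  show "inj_on (\<lambda>x. \<lambda>i\<in>I. \<phi> i x) (carr A)"
    using dec unfolding alg_decomposition_def bij_betw_def by (elim conjE)
  show "(\<lambda>i\<in>I. \<phi> i x) = (\<lambda>i\<in>I. \<phi> i y)"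
    by (rule restrict_ext) (rule assms(3))
qed (rule assms(1,2))+

lemma components_exist:
  assumes "\<And>i. i \<in> I \<Longrightarrow> y i \<in> carr (Fs ! i)"
  shows "\<exists>x\<in>carr A. \<forall>i\<in>I. \<phi> i x = y i"
proof -
  have "restrict y I \<in> (\<lambda>x. \<lambda>i\<in>I. \<phi> i x) ` carr A"
    using dec assms by (simp add: alg_decomposition_def bij_betw_def)
  then obtain x where x: "x \<in> carr A" "restrict y I = (\<lambda>i\<in>I. \<phi> i x)"
    by blast
  have "\<phi> i x = y i" if "i \<in> I" for i
    using fun_cong[OF x(2), of i] that by simp
  then show ?thesis
    using x(1) by blast
qed

text \<open>
  Multiplication by the element with components \<open>1\<close> on \<open>J\<close> and \<open>0\<close> elsewhere is the projection onto
  the factors in \<open>J\<close>, so the portion is a corner and the results on corners apply to it.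
\<close>

lemma portion_eq_corner:
  assumes e: "e \<in> carr A" "\<And>i. i \<in> I \<Longrightarrow> \<phi> i e = (if i \<in> J then uni (Fs ! i) else 0)"
  shows "idem e" "portion A Fs \<phi> J = corner A e"
proof -
  have mult: "\<phi> i (e \<odot> x) = (if i \<in> J then \<phi> i x else 0)" if x: "x \<in> carr A" and i: "i \<in> I" for x i
  proof -
    interpret F: fd_algebra "Fs ! i" by unfold_locales (rule factor_algebra[OF i])
    have "\<phi> i (e \<odot> x) = mul (Fs ! i) (\<phi> i e) (\<phi> i x)"
      by (rule factor_homD(3)[OF i e(1) x])
    then show ?thesis
      using e(2)[OF i] factor_homD(1)[OF i x] by (cases "i \<in> J") simp_all
  qed
  show "idem e"
  proof -
    have "\<phi> i (e \<odot> e) = \<phi> i e" if "i \<in> I" for i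
      using mult[OF e(1) that] e(2)[OF that] by simp
    then have "e \<odot> e = e"
      by (rule components_inject[OF carr_closed(3)[OF e(1) e(1)] e(1)])
    then show ?thesis
      using e(1) by (simp add: idem_def)
  qed
  have "(\<forall>i<length Fs. i \<notin> J \<longrightarrow> \<phi> i x = 0) \<longleftrightarrow> e \<odot> x = x" if x: "x \<in> carr A" for x
  proof
    assume "\<forall>i<length Fs. i \<notin> J \<longrightarrow> \<phi> i x = 0"
    then have comp: "\<phi> i (e \<odot> x) = \<phi> i x" if "i \<in> I" for i
      using mult[OF x that] that by simp
    show "e \<odot> x = x"
      by (rule components_inject[OF carr_closed(3)[OF e(1) x] x comp])
  next
    assume ex: "e \<odot> x = x"
    show "\<forall>i<length Fs. i \<notin> J \<longrightarrow> \<phi> i x = 0"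
    proof (intro allI impI)
      fix i assume "i < length Fs" "i \<notin> J"
      then show "\<phi> i x = 0"
        using mult[OF x, of i] unfolding ex by simp
    qed
  qed
  moreover have "(THE u. u \<in> carr A \<and> (\<forall>i<length Fs. \<phi> i u = (if i \<in> J then uni (Fs ! i) else 0))) = e"
  proof (rule the_equality)
    show "u = e" if "u \<in> carr A \<and> (\<forall>i<length Fs. \<phi> i u = (if i \<in> J then uni (Fs ! i) else 0))" for u
      by (rule components_inject) (use that e in simp_all)
  qed (use e in simp)
  ultimately show "portion A Fs \<phi> J = corner A e"
    unfolding portion_def corner_def by (simp cong: conj_cong)
qed

lemma portion_unit_exists: "\<exists>e\<in>carr A. \<forall>i\<in>I. \<phi> i e = (if i \<in> J then uni (Fs ! i) else 0)"
proof -
  have "(if i \<in> J then uni (Fs ! i) else 0) \<in> carr (Fs ! i)" if "i \<in> I" for i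
  proof -
    interpret F: fd_algebra "Fs ! i" by unfold_locales (rule factor_algebra[OF that])
    show ?thesis by simp
  qed
  then show ?thesis by (rule components_exist)
qed

lemma exp_component: "i \<in> I \<Longrightarrow> x \<in> carr A \<Longrightarrow> \<phi> i (alg_exp A x) = alg_exp (Fs ! i) (\<phi> i x)"
  by (rule hom_exp[OF is_algebra factor_algebra factor_hom])

lemma component_0: "i \<in> I \<Longrightarrow> \<phi> i 0 = 0"
  by (rule hom_0[OF is_algebra factor_algebra factor_hom])

definition type_C_indices where "type_C_indices = {i. i < length Fs \<and> type_C (Fs ! i)}"

text \<open>
  Since \<open>\<phi> i\<close> maps the unit \<open>e\<close> of the corner to that of the factor, it restricts to a unital
  homomorphism on the corner and maps periods to periods.
\<close>

lemma exp_corner_component: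
  assumes e: "idem e" and z: "z \<in> carr A" "e \<odot> z = z" and eq: "alg_exp (corner A e) z = e"
    and i: "i \<in> I" "\<phi> i e = uni (Fs ! i)"
  shows "alg_exp (Fs ! i) (\<phi> i z) = uni (Fs ! i)"
proof -
  interpret F: fd_algebra "Fs ! i" by unfold_locales (rule factor_algebra[OF i(1)])
  have ec: "e \<in> carr A" using e by (simp add: idem_def)
  have "e \<odot> alg_exp A z = e"
    using exp_corner[OF e z(1)] z(2) eq by simp
  then have "\<phi> i (e \<odot> alg_exp A z) = uni (Fs ! i)"
    using i(2) by simp
  then show ?thesis
    using i z(1) ec exp_component[OF i(1) z(1)] factor_homD(1)[OF i(1) exp_closed[OF z(1)]]
    by (simp add: factor_homD(3))
qed

context
  assumes nil_factors: "\<And>i. i \<in> I \<Longrightarrow> unital_nil_algebra (Fs ! i)"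
begin

text \<open>
  A factor of type-C is a complex nil algebra, and the others are real nil algebras, which have no
  nonzero periods. The components in the factors of type-C vanish on the portion.
\<close>

lemma real_portion_exp_inj:
  assumes e: "idem e" and \<phi>e: "\<And>i. i \<in> I \<Longrightarrow> \<phi> i e = (if i \<in> type_C_indices then 0 else uni (Fs ! i))"
  shows "inj_on (alg_exp (corner A e)) (carr (corner A e))"
proof -
  interpret C: fd_algebra "corner A e" by unfold_locales (rule is_algebra_corner[OF e])
  have ec: "e \<in> carr A" using e by (simp add: idem_def)
  have "z = 0" if z: "z \<in> carr A" "e \<odot> z = z" "alg_exp (corner A e) z = e" for z
  proof (rule components_inject)
    fix i assume i: "i \<in> I"
    interpret F: fd_algebra "Fs ! i" by unfold_locales (rule factor_algebra[OF i])
    have "\<phi> i z = 0"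
    proof (cases "i \<in> type_C_indices")
      case True
      have "\<phi> i (e \<odot> z) = 0"
        using True \<phi>e[OF i] factor_homD(1)[OF i z(1)] ec z(1) by (simp add: factor_homD(3)[OF i])
      then show ?thesis
        using z(2) by simp
    next
      case False
      then have "\<phi> i e = uni (Fs ! i)"
        using \<phi>e[OF i] by simp
      then have per: "alg_exp (Fs ! i) (\<phi> i z) = uni (Fs ! i)"
        by (rule exp_corner_component[OF e z i])
      show ?thesis
      proof (rule ccontr)
        assume "\<phi> i z \<noteq> 0"
        then have "complex_nil_algebra (Fs ! i)"
          using unital_nil_algebra_period_imp_complex_nil[OF nil_factors[OF i] factor_homD(1)[OF i z(1)] _ per] by blast
        then have "type_C (Fs ! i)"
          by (rule complex_nil_algebra_imp_type_C)
        then show False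
          using False i by (simp add: type_C_indices_def)
      qed
    qed
    then show "\<phi> i z = \<phi> i 0"
      by (simp add: component_0[OF i])
  qed (use z in simp_all)
  then show ?thesis
    unfolding C.exp_inj_iff by simp
qed

text \<open>
  The periods of the complex portion are independent integral multiples of \<open>2 * pi * \<i>\<close>, one for each
  factor. The imaginary parts of the components modulo nilpotents are the coordinates required by
  \<open>infinite_logarithms\<close>.
\<close>

lemma complex_portion_infinite_logarithms:
  assumes e: "idem e" and \<phi>e: "\<And>i. i \<in> I \<Longrightarrow> \<phi> i e = (if i \<in> type_C_indices then uni (Fs ! i) else 0)"
    and type_C_indices: "type_C_indices \<noteq> {}"
  shows "infinite (logarithms (corner A e))"
proof -
  interpret C: fd_algebra "corner A e" by unfold_locales (rule is_algebra_corner[OF e])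
  have ec: "e \<in> carr A" using e by (simp add: idem_def)
  have JI: "i \<in> I" if "i \<in> type_C_indices" for i
    using that by (simp add: type_C_indices_def)
  have "\<exists>\<iota>. residue_complex (Fs ! i) \<iota>" if i: "i \<in> type_C_indices" for i
  proof -
    interpret F: fd_algebra "Fs ! i" by unfold_locales (rule factor_algebra[OF JI[OF i]])
    have "complex_nil_algebra (Fs ! i)"
      using unital_nil_algebra_type_C_imp_complex_nil[OF nil_factors[OF JI[OF i]]] i by (simp add: type_C_indices_def)
    then show ?thesis
      by (simp add: F.complex_nil_algebra_iff)
  qed
  then obtain \<iota> where \<iota>: "\<And>i. i \<in> type_C_indices \<Longrightarrow> residue_complex (Fs ! i) (\<iota> i)"
    by metis
  have \<iota>_hom: "alg_hom complex_alg (Fs ! i) (\<iota> i)" if "i \<in> type_C_indices" for i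
    using \<iota>[OF that] by (simp add: residue_complex_def)
  note \<iota>D = complex_homD[OF factor_algebra[OF JI] \<iota>_hom]
  have outside: "\<phi> i x = 0" if x: "x \<in> carr (corner A e)" and i: "i \<in> I" "i \<notin> type_C_indices" for x i
  proof -
    interpret F: fd_algebra "Fs ! i" by unfold_locales (rule factor_algebra[OF i(1)])
    have xc: "x \<in> carr A" "e \<odot> x = x"
      using x by simp_all
    have "\<phi> i (e \<odot> x) = 0"
      using \<phi>e[OF i(1)] i(2) factor_homD(1)[OF i(1) xc(1)] ec xc(1)
      by (simp add: factor_homD(3)[OF i(1)])
    then show ?thesis
      using xc by simp
  qed
  define h where "h i x = Im (fd_algebra.residue (Fs ! i) (\<iota> i) (\<phi> i x))" for i x
  have res: "fd_algebra.residue (Fs ! i) (\<iota> i) (\<iota> i c) = c"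
    and res_add: "x \<in> carr (Fs ! i) \<Longrightarrow> y \<in> carr (Fs ! i) \<Longrightarrow>
      fd_algebra.residue (Fs ! i) (\<iota> i) (x + y) =
      fd_algebra.residue (Fs ! i) (\<iota> i) x + fd_algebra.residue (Fs ! i) (\<iota> i) y"
    and res_scale: "x \<in> carr (Fs ! i) \<Longrightarrow>
      fd_algebra.residue (Fs ! i) (\<iota> i) (r *\<^sub>R x) = r *\<^sub>R fd_algebra.residue (Fs ! i) (\<iota> i) x"
    if i: "i \<in> type_C_indices" for i c x y r
  proof -
    interpret F: fd_algebra "Fs ! i" by unfold_locales (rule factor_algebra[OF JI[OF i]])
    note S = F.residue_simps[OF \<iota>[OF i]]
    show "F.residue (\<iota> i) (\<iota> i c) = c"
      by (rule S(1))
    show "F.residue (\<iota> i) (x + y) = F.residue (\<iota> i) x + F.residue (\<iota> i) y"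
      if "x \<in> carr (Fs ! i)" "y \<in> carr (Fs ! i)"
      using that by (rule S(2))
    show "F.residue (\<iota> i) (r *\<^sub>R x) = r *\<^sub>R F.residue (\<iota> i) x" if "x \<in> carr (Fs ! i)"
      using that by (rule S(3))
  qed
  have kernel: "\<exists>k :: int. \<phi> i z = \<iota> i (\<i> * of_real (2 * pi * of_int k))"
    if z: "z \<in> carr (corner A e)" "alg_exp (corner A e) z = e" and i: "i \<in> type_C_indices" for z i
  proof -
    interpret F: fd_algebra "Fs ! i" by unfold_locales (rule factor_algebra[OF JI[OF i]])
    have zc: "z \<in> carr A" "e \<odot> z = z"
      using z(1) by simp_all
    have "\<phi> i e = uni (Fs ! i)"
      using \<phi>e[OF JI[OF i]] i by simp
    then have "alg_exp (Fs ! i) (\<phi> i z) = uni (Fs ! i)"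
      by (rule exp_corner_component[OF e zc z(2) JI[OF i]])
    then obtain k :: int where "\<phi> i z = \<iota> i (\<i> * of_real (2 * pi * of_int k))"
      by (rule F.residue_complex_exp_eq_unit[OF \<iota>[OF i] factor_homD(1)[OF JI[OF i] zc(1)]])
    then show ?thesis by blast
  qed
  show ?thesis
  proof (rule C.infinite_logarithms[OF type_C_indices, of h])
    fix i x y and r :: real
    assume i: "i \<in> type_C_indices" and x: "x \<in> carr (corner A e)"
    note xc = factor_homD(1)[OF JI[OF i]]
    show "h i (r *\<^sub>R x) = r * h i x"
      using x xc by (simp add: h_def factor_homD(4)[OF JI[OF i]] res_scale[OF i])
    show "h i (x + y) = h i x + h i y" if "y \<in> carr (corner A e)"
      using x that xc by (simp add: h_def factor_homD(2)[OF JI[OF i]] res_add[OF i])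
  next
    fix k :: "nat \<Rightarrow> int"
    let ?c = "\<lambda>i. \<i> * of_real (2 * pi * of_int (k i)) :: complex"
    let ?y = "\<lambda>i. if i \<in> type_C_indices then \<iota> i (?c i) else 0"
    have "?y i \<in> carr (Fs ! i)" if "i \<in> I" for i
    proof -
      interpret F: fd_algebra "Fs ! i" by unfold_locales (rule factor_algebra[OF that])
      show ?thesis using \<iota>D(1)[of i] by (cases "i \<in> type_C_indices") simp_all
    qed
    then have "\<exists>p\<in>carr A. \<forall>i\<in>I. \<phi> i p = ?y i"
      by (rule components_exist)
    then obtain p where p: "p \<in> carr A" "\<And>i. i \<in> I \<Longrightarrow> \<phi> i p = ?y i"
      by blast
    have exp_c: "exp (?c i) = 1" for i
      by (simp add: exp_eq_1)
    have comp: "\<phi> i (e \<odot> p) = \<phi> i p \<and> \<phi> i (e \<odot> alg_exp A p) = \<phi> i e" if i: "i \<in> I" for i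
    proof
      interpret F: fd_algebra "Fs ! i" by unfold_locales (rule factor_algebra[OF i])
      have \<phi>p: "\<phi> i p \<in> carr (Fs ! i)"
        by (rule factor_homD(1)[OF i p(1)])
      show "\<phi> i (e \<odot> p) = \<phi> i p"
        using \<phi>p factor_homD(3)[OF i ec p(1)] \<phi>e[OF i] p(2)[OF i] by (cases "i \<in> type_C_indices") simp_all
      have "alg_exp (Fs ! i) (\<phi> i p) = uni (Fs ! i)" if "i \<in> type_C_indices"
        using \<iota>D(5,10)[OF that] exp_c p(2)[OF i] that by simp
      then show "\<phi> i (e \<odot> alg_exp A p) = \<phi> i e"
        using \<phi>p factor_homD(3)[OF i ec exp_closed[OF p(1)]] \<phi>e[OF i] exp_component[OF i p(1)]
        by (cases "i \<in> type_C_indices") simp_all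
    qed
    have "e \<odot> p = p" "e \<odot> alg_exp A p = e"
      by (rule components_inject; use comp ec p(1) in simp)+
    then have "p \<in> carr (corner A e)" "alg_exp (corner A e) p = uni (corner A e)"
      using p(1) exp_corner[OF e p(1)] by simp_all
    moreover have "h i p = 2 * pi * k i" if "i \<in> type_C_indices" for i
      using p(2)[OF JI[OF that]] that by (simp add: h_def res[OF that])
    ultimately show "\<exists>p\<in>carr (corner A e). alg_exp (corner A e) p = uni (corner A e) \<and>
        (\<forall>i\<in>type_C_indices. h i p = 2 * pi * k i)"
      by blast
  next
    fix z assume z: "z \<in> carr (corner A e)" "alg_exp (corner A e) z = uni (corner A e)"
    have ze: "alg_exp (corner A e) z = e"
      using z(2) by simp
    have ker: "\<exists>m :: int. h i z = 2 * pi * m \<and> (h i z = 0 \<longrightarrow> \<phi> i z = 0)" if i: "i \<in> type_C_indices" for i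
    proof -
      obtain k :: int where k: "\<phi> i z = \<iota> i (\<i> * of_real (2 * pi * of_int k))"
        using kernel[OF z(1) ze i] by blast
      then have "h i z = 2 * pi * k"
        by (simp add: h_def res[OF i])
      then show ?thesis
        using k \<iota>D(6)[OF i i] by (intro exI[of _ k]) simp
    qed
    moreover have "z = 0" if "\<forall>i\<in>type_C_indices. h i z = 0"
    proof (rule components_inject)
      show "\<phi> i z = \<phi> i 0" if i: "i \<in> I" for i
        using outside[OF z(1) i] ker[of i] \<open>\<forall>i\<in>type_C_indices. h i z = 0\<close> component_0[OF i] by (cases "i \<in> type_C_indices") auto
    qed (use z in simp_all)
    ultimately show "(\<forall>i\<in>type_C_indices. \<exists>m :: int. h i z = 2 * pi * m) \<and> ((\<forall>i\<in>type_C_indices. h i z = 0) \<longrightarrow> z = 0)"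
      by blast
  qed
qed

lemma period_imp_type_C_factor:
  assumes z: "z \<in> carr A" "z \<noteq> 0" "alg_exp A z = \<one>"
  shows "type_C_indices \<noteq> {}"
proof -
  have "\<exists>i\<in>I. \<phi> i z \<noteq> \<phi> i 0"
    using components_inject[of z 0] z by auto
  then obtain i where i: "i \<in> I" "\<phi> i z \<noteq> 0"
    using component_0 by force
  have "alg_exp (Fs ! i) (\<phi> i z) = uni (Fs ! i)"
    using exp_component[OF i(1) z(1)] z(3) factor_homD(5)[OF i(1) z(1)] by simp
  then have "complex_nil_algebra (Fs ! i)"
    using unital_nil_algebra_period_imp_complex_nil nil_factors factor_homD(1)[OF i(1) z(1)] i by blast
  then have "type_C (Fs ! i)"
    by (rule complex_nil_algebra_imp_type_C)
  then show ?thesis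
    using i(1) by (auto simp: type_C_indices_def)
qed

lemma logs_determined_by_complex_portion:
  assumes "\<not> type_R A"
  shows "logs_determined_by A (real_portion A Fs \<phi>) (complex_portion A Fs \<phi>)"
proof -
  obtain z where "z \<in> carr A" "z \<noteq> 0" "alg_exp A z = \<one>"
    by (rule not_type_R_period[OF assms])
  then have type_C_indices: "type_C_indices \<noteq> {}"
    by (rule period_imp_type_C_factor)
  obtain e where e: "e \<in> carr A" "\<And>i. i \<in> I \<Longrightarrow> \<phi> i e = (if i \<in> type_C_indices then uni (Fs ! i) else 0)"
    using portion_unit_exists[of type_C_indices] by blast
  have e': "\<one> - e \<in> carr A" "\<And>i. i \<in> I \<Longrightarrow> \<phi> i (\<one> - e) = (if i \<in> type_C_indices then 0 else uni (Fs ! i))"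
  proof -
    show "\<phi> i (\<one> - e) = (if i \<in> type_C_indices then 0 else uni (Fs ! i))" if i: "i \<in> I" for i
      using e(2)[OF i] hom_diff[OF is_algebra factor_algebra[OF i] factor_hom[OF i] _ e(1), of \<one>]
        factor_homD(5)[OF i e(1)] by simp
  qed (use e in simp)
  have "complex_portion A Fs \<phi> = corner A e"
    unfolding complex_portion_def type_C_indices_def[symmetric] using e by (rule portion_eq_corner(2))
  moreover have "real_portion A Fs \<phi> = corner A (\<one> - e)"
    unfolding real_portion_def
  proof (rule portion_eq_corner(2)[OF e'(1)])
    show "\<phi> i (\<one> - e) = (if i \<in> {i. i < length Fs \<and> \<not> type_C (Fs ! i)} then uni (Fs ! i) else 0)"
      if "i \<in> I" for i
      using e'(2)[OF that] that by (simp add: type_C_indices_def)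
  qed
  moreover have idem: "idem e"
    using e by (rule portion_eq_corner(1))
  ultimately show ?thesis
    using logs_determined_by_corner[OF idem real_portion_exp_inj[OF idem_complement[OF idem] e'(2)]
        complex_portion_infinite_logarithms[OF idem e(2) type_C_indices]]
    by simp
qed

end

end

text \<open>
  The factors \<open>\<real>\<close> and \<open>\<complex>\<close> are themselves unital nil algebras, without nonzero nilpotent elements, so
  all factors of a decomposition can be treated alike.
\<close>

lemma unital_nil_algebra_of_iso_real:
  assumes "is_algebra F" "alg_iso F real_alg"
  shows "unital_nil_algebra F"
proof -
  interpret fd_algebra F by unfold_locales (rule assms(1))
  obtain f where f: "alg_hom F real_alg f" "bij_betw f (carr F) (carr real_alg)"
    using assms(2) by (auto simp: alg_iso_def)
  have inj: "x = y" if "x \<in> carr F" "y \<in> carr F" "f x = f y" for x y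
    using f(2) that by (auto simp: bij_betw_def dest: inj_onD)
  have f1: "f (uni F) = 1"
    using alg_homD(5)[OF f(1), of 0] by (simp add: real_alg_def)
  have "x = f x *\<^sub>R uni F" if "x \<in> carr F" for x
    using that f1 by (intro inj) (simp_all add: alg_homD(4)[OF f(1)])
  then have "nil (x - f x *\<^sub>R uni F)" if "x \<in> carr F" for x
    using that by (metis nil_0 right_minus_eq)
  moreover have "uni F \<noteq> 0"
    using f1 hom_0[OF assms(1) is_algebra_real f(1)] by auto
  ultimately show ?thesis
    by (auto simp: unital_nil_algebra_def real_nil_algebra_iff residue_real_def)
qed

lemma unital_nil_algebra_of_iso_complex:
  assumes "is_algebra F" "alg_iso F complex_alg"
  shows "unital_nil_algebra F"
proof -
  interpret fd_algebra F by unfold_locales (rule assms(1))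
  obtain f where f: "alg_hom F complex_alg f" "bij_betw f (carr F) (carr complex_alg)"
    using assms(2) by (auto simp: alg_iso_def)
  let ?g = "inv_into (carr F) f"
  have "nil (x - ?g (f x))" if "x \<in> carr F" for x
    using that f(2) by (simp add: bij_betw_inv_into_left)
  moreover have "uni F \<noteq> 0"
    using alg_homD(5)[OF f(1), of 0] hom_0[OF assms(1) is_algebra_complex f(1)]
    by (auto simp: complex_alg_def)
  ultimately have "residue_complex F ?g"
    using alg_hom_inverse[OF assms(1) f] unfolding residue_complex_def by blast
  then show ?thesis
    by (auto simp: unital_nil_algebra_def complex_nil_algebra_iff)
qed

lemma nil_decomposition_factors:
  assumes "nil_decomposition A Ns Rs Cs \<phi>" "i < length (Ns @ Rs @ Cs)"
  shows "unital_nil_algebra ((Ns @ Rs @ Cs) ! i)"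
proof -
  let ?F = "(Ns @ Rs @ Cs) ! i"
  have "is_algebra ?F"
    using assms by (auto simp: nil_decomposition_def alg_decomposition_def)
  moreover have "?F \<in> set Ns \<or> ?F \<in> set Rs \<or> ?F \<in> set Cs"
    using nth_mem[OF assms(2)] by simp
  ultimately show ?thesis
    using assms(1) unital_nil_algebra_of_iso_real unital_nil_algebra_of_iso_complex
    unfolding nil_decomposition_def by blast
qed

section \<open>Decomposition and logarithms\<close>

theorem proposition2p20:
  fixes A :: "('a::euclidean_space) alg"
  assumes "is_algebra A" and "multiplicative A"
  shows "(\<exists>Ns Rs Cs \<phi>. nil_decomposition A Ns Rs Cs \<phi>) \<and>
    (type_R A \<longrightarrow> (\<exists>!l. exp_inverse A l)) \<and>
    (\<not> type_R A \<longrightarrow>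
       infinite (logarithms A) \<and>
       (\<forall>Ns Rs Cs \<phi>. nil_decomposition A Ns Rs Cs \<phi> \<longrightarrow>
          logs_determined_by A
            (real_portion A (Ns @ Rs @ Cs) \<phi>) (complex_portion A (Ns @ Rs @ Cs) \<phi>)))"
proof -
  interpret fd_algebra A by unfold_locales (rule assms(1))
  have logs: "logs_determined_by A (real_portion A (Ns @ Rs @ Cs) \<phi>) (complex_portion A (Ns @ Rs @ Cs) \<phi>)"
    if "\<not> type_R A" and nd: "nil_decomposition A Ns Rs Cs \<phi>" for Ns Rs Cs \<phi>
  proof -
    interpret decomposed_algebra A "Ns @ Rs @ Cs" \<phi>
      by unfold_locales (use nd in \<open>simp add: nil_decomposition_def\<close>)
    show ?thesis
      by (rule logs_determined_by_complex_portion) (use that nil_decomposition_factors[OF nd] in auto)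
  qed
  have "infinite (logarithms A)" if "\<not> type_R A"
    using ex_nil_decomposition logs[OF that] logs_determined_by_infinite by blast
  then show ?thesis
    using ex_nil_decomposition type_R_imp_exp_inj ex1_exp_inverse[of A] logs by blast
qed

end
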